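(* Let $N\ge 1$, $T\in[0,\infty)$ and $x_0\in\mathbb{R}^N$. For all $i,j\in\{1,\dots,N\}$ let $p_{ij}:\mathbb{R}^N\to[0,1]$ be globally Lipschitz continuous, and assume there exists $c>0$ such that $p_{ii}(x)>c$ for all $x\in\mathbb{R}^N$ and all $i$. For $h>0$ let $X^h$ be the trajectory on $[0,T]$ of the agent-based model with selection by interaction probability (described in the context), with timestep $h$, initial opinions $x_0$ and update distance $\mu^h=Nh$. Then, as $h\to0$, $X^h$ converges in distribution in $D([0,T],\mathbb{R}^N)$ to the solution $X=(X(t):t\in[0,T])$ of $$\frac{dX_i}{dt}=\Bigl(\sum_{\ell=1}^N p_{i\ell}(X)\Bigr)^{-1}\sum_{j=1}^N p_{ij}(X)\,(X_j-X_i),\quad i=1,\dots,N,\qquad X(0)=x_0 .$$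
   Context: Agent-based model with timestep $h>0$ and selection by interaction probability: the opinions $x(t)\in\mathbb{R}^N$ evolve at times $t=0,h,2h,\dots$ as a discrete-time Markov chain with $x(0)=x_0$. At each timestep an individual $i$ is chosen uniformly at random from $\{1,\dots,N\}$, independently of the past; then, given the current state $x=x(t)$, a second individual $j\in\{1,\dots,N\}$ is selected with probability $$\pi_j(x)=\frac{p_{ij}(x)}{\sum_{\ell=1}^N p_{i\ell}(x)}$$ ($j=i$ allowed). An interaction then always occurs: $x_i(t+h)=x_i(t)+\mu^h\,(x_j(t)-x_i(t))$, and all other coordinates are unchanged. The trajectory $X^h=(X^h_t)_{t\in[0,T]}$ is the piecewise constant process $X^h_t=x(h\lfloor t/h\rfloor)$, viewed as a random element of the Skorokhod space $D([0,T],\mathbb{R}^N)$ of càdlàg functions. Convergence in distribution means $\mathbb{E}[f(X^h)]\to\mathbb{E}[f(X)]$ for every bounded continuous real-valued $f$ on $D([0,T],\mathbb{R}^N)$. *)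

theory Defs
  imports "HOL-Probability.Probability"
begin

section \<open>The Skorokhod space on a compact interval\<close>

text \<open>Functions on \<open>[0,T]\<close> are represented extensionally, so that equality in the type
  is equality on \<open>[0,T]\<close>. At \<open>t = 0\<close> the left-limit condition is vacuous, because the
  filter \<open>at 0 within {0..<0}\<close> is trivial.\<close>

definition cadlag_space :: "real \<Rightarrow> (real \<Rightarrow> 'b::metric_space) set" where
  "cadlag_space T = {f \<in> extensional {0..T}. \<forall>t\<in>{0..T}.
     (f \<longlongrightarrow> f t) (at t within {t<..T}) \<and> (\<exists>l. (f \<longlongrightarrow> l) (at t within {0..<t}))}"

definition time_changes :: "real \<Rightarrow> (real \<Rightarrow> real) set" where
  "time_changes T = {\<tau>. continuous_on {0..T} \<tau> \<and> strict_mono_on {0..T} \<tau> \<and> \<tau> ` {0..T} = {0..T}}"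

text \<open>The Skorokhod (J1) metric in Billingsley's form. The value \<open>0\<close> outside the space is
  irrelevant; it is there because the locale \<^locale>\<open>Metric_space\<close> asks for nonnegativity
  on the whole type.\<close>

definition skorokhod_dist ::
  "real \<Rightarrow> (real \<Rightarrow> 'b::metric_space) \<Rightarrow> (real \<Rightarrow> 'b) \<Rightarrow> real" where
  "skorokhod_dist T f g =
     (if f \<in> cadlag_space T \<and> g \<in> cadlag_space T
      then Inf {e. \<exists>\<tau>\<in>time_changes T. \<forall>t\<in>{0..T}. \<bar>\<tau> t - t\<bar> \<le> e \<and> dist (f t) (g (\<tau> t)) \<le> e}
      else 0)"

definition skorokhod_topology :: "real \<Rightarrow> (real \<Rightarrow> 'b::metric_space) topology" where
  "skorokhod_topology T = Metric_space.mtopology (cadlag_space T) (skorokhod_dist T)"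

definition skorokhod_bound ::
  "real \<Rightarrow> (real \<Rightarrow> 'b::metric_space) \<Rightarrow> (real \<Rightarrow> 'b) \<Rightarrow> (real \<Rightarrow> real) \<Rightarrow> real \<Rightarrow> bool" where
  "skorokhod_bound T f g \<tau> e \<longleftrightarrow>
     \<tau> \<in> time_changes T \<and> (\<forall>t\<in>{0..T}. \<bar>\<tau> t - t\<bar> \<le> e \<and> dist (f t) (g (\<tau> t)) \<le> e)"

lemma skorokhod_dist_eq:
  "f \<in> cadlag_space T \<Longrightarrow> g \<in> cadlag_space T \<Longrightarrow>
   skorokhod_dist T f g = Inf {e. \<exists>\<tau>. skorokhod_bound T f g \<tau> e}"
  unfolding skorokhod_dist_def skorokhod_bound_def Bex_def by (simp only: if_True simp_thms)

lemma time_change_id: "(\<lambda>t. t) \<in> time_changes T"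
  by (simp add: time_changes_def strict_mono_on_def)

lemma time_change_in: "l \<in> time_changes T \<Longrightarrow> t \<in> {0..T} \<Longrightarrow> l t \<in> {0..T}"
  by (auto simp: time_changes_def)

lemma time_change_inv:
  assumes "l \<in> time_changes T"
  obtains k where "k \<in> time_changes T" "\<And>t. t \<in> {0..T} \<Longrightarrow> l (k t) = t"
    "\<And>t. t \<in> {0..T} \<Longrightarrow> k (l t) = t"
proof -
  have c: "continuous_on {0..T} l" and m: "strict_mono_on {0..T} l" and i: "l ` {0..T} = {0..T}"
    using assms by (auto simp: time_changes_def)
  have inj: "inj_on l {0..T}" using m by (rule strict_mono_on_imp_inj_on)
  define k where "k = inv_into {0..T} l"
  have kl: "k (l t) = t" if "t \<in> {0..T}" for t using inj that by (simp add: k_def)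
  have lk: "l (k t) = t" if "t \<in> {0..T}" for t using i that by (simp add: k_def f_inv_into_f)
  have kin: "k t \<in> {0..T}" if "t \<in> {0..T}" for t
    using i that unfolding k_def by (metis inv_into_into)
  have "continuous_on {0..T} k"
    using continuous_on_inv[OF c, of k] kl i by auto
  moreover have "strict_mono_on {0..T} k"
    unfolding strict_mono_on_def
  proof (intro allI impI)
    fix r s assume rs: "r \<in> {0..T} \<and> s \<in> {0..T} \<and> r < s"
    show "k r < k s"
    proof (rule ccontr)
      assume "\<not> k r < k s"
      then have "k s \<le> k r" by simp
      then have "l (k s) \<le> l (k r)"
        using strict_mono_on_leD[OF m, of "k s" "k r"] kin rs by blast
      then show False using lk rs by auto
    qed
  qed
  moreover have "k ` {0..T} = {0..T}"
  proof
    show "k ` {0..T} \<subseteq> {0..T}" using kin by blast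
    show "{0..T} \<subseteq> k ` {0..T}"
    proof
      fix t assume t: "t \<in> {0..T}"
      then have "l t \<in> {0..T}" using i by blast
      then show "t \<in> k ` {0..T}" using kl[OF t] by (metis imageI)
    qed
  qed
  ultimately have "k \<in> time_changes T" by (simp add: time_changes_def)
  then show ?thesis using that lk kl by blast
qed

lemma time_change_comp:
  assumes "l \<in> time_changes T" "k \<in> time_changes T"
  shows "(\<lambda>t. k (l t)) \<in> time_changes T"
proof -
  have "continuous_on {0..T} (\<lambda>t. k (l t))"
    using assms by (intro continuous_on_compose2[of "{0..T}" k "{0..T}" l]) (auto simp: time_changes_def)
  moreover have "strict_mono_on {0..T} (\<lambda>t. k (l t))"
    using assms unfolding strict_mono_on_def
    by (metis (no_types, lifting) mem_Collect_eq strict_mono_on_def time_change_in time_changes_def)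
  moreover have "(\<lambda>t. k (l t)) ` {0..T} = {0..T}"
    using assms by (simp add: time_changes_def flip: image_image[of k l])
  ultimately show ?thesis by (simp add: time_changes_def)
qed

lemma time_change_end:
  assumes "l \<in> time_changes T" "0 \<le> T"
  shows "l T = T"
proof -
  obtain s where s: "s \<in> {0..T}" "l s = T"
    using assms by (force simp: time_changes_def)
  have "l s \<le> l T"
    using assms s strict_mono_on_leD[of "{0..T}" l s T] by (auto simp: time_changes_def)
  moreover have "l T \<le> T" using time_change_in[OF assms(1), of T] assms(2) by auto
  ultimately show ?thesis using s by simp
qed

lemma skorokhod_bound_inv:
  assumes "skorokhod_bound T f g l e"
  shows "\<exists>k. skorokhod_bound T g f k e"
proof -
  have l: "l \<in> time_changes T" using assms by (simp add: skorokhod_bound_def)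
  obtain k where k: "k \<in> time_changes T" "\<And>t. t \<in> {0..T} \<Longrightarrow> l (k t) = t"
    using time_change_inv[OF l] by metis
  have "\<bar>k t - t\<bar> \<le> e \<and> dist (g t) (f (k t)) \<le> e" if t: "t \<in> {0..T}" for t
  proof -
    have "\<bar>l (k t) - k t\<bar> \<le> e \<and> dist (f (k t)) (g (l (k t))) \<le> e"
      using assms time_change_in[OF k(1) t] by (simp add: skorokhod_bound_def)
    then show ?thesis using k(2)[OF t] by (simp add: abs_minus_commute dist_commute)
  qed
  then show ?thesis using k(1) by (auto simp: skorokhod_bound_def)
qed

lemma skorokhod_bound_comp:
  assumes "skorokhod_bound T f g l d" "skorokhod_bound T g h k e"
  shows "skorokhod_bound T f h (\<lambda>t. k (l t)) (d + e)"
proof -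
  have "\<bar>k (l t) - t\<bar> \<le> d + e \<and> dist (f t) (h (k (l t))) \<le> d + e" if t: "t \<in> {0..T}" for t
  proof -
    have lt: "l t \<in> {0..T}" using time_change_in assms(1) t by (auto simp: skorokhod_bound_def)
    have "\<bar>l t - t\<bar> \<le> d" "dist (f t) (g (l t)) \<le> d"
      using assms(1) t by (auto simp: skorokhod_bound_def)
    moreover have "\<bar>k (l t) - l t\<bar> \<le> e" "dist (g (l t)) (h (k (l t))) \<le> e"
      using assms(2) lt by (auto simp: skorokhod_bound_def)
    ultimately show ?thesis
      using dist_triangle[of "f t" "h (k (l t))" "g (l t)"] by linarith
  qed
  then show ?thesis using assms time_change_comp by (auto simp: skorokhod_bound_def)
qed

lemma skorokhod_bound_nonneg: "0 \<le> T \<Longrightarrow> skorokhod_bound T f g l e \<Longrightarrow> 0 \<le> e"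
  by (meson abs_ge_zero atLeastAtMost_iff order_refl order_trans skorokhod_bound_def)

lemma cadlag_bounded:
  fixes f :: "real \<Rightarrow> 'b::metric_space"
  assumes f: "f \<in> cadlag_space T"
  shows "bounded (f ` {0..T})"
proof -
  have "\<exists>U. open U \<and> t \<in> U \<and> bounded (f ` (U \<inter> {0..T}))" if t: "t \<in> {0..T}" for t
  proof -
    have r: "(f \<longlongrightarrow> f t) (at t within {t<..T})" and "\<exists>l. (f \<longlongrightarrow> l) (at t within {0..<t})"
      using f t by (auto simp: cadlag_space_def)
    then obtain l where l: "(f \<longlongrightarrow> l) (at t within {0..<t})" by blast
    have "eventually (\<lambda>s. dist (f s) (f t) < 1) (at t within {t<..T})"
      using r by (simp add: tendsto_iff)
    then obtain d1 where d1: "d1 > 0"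
      "\<And>s. s \<in> {t<..T} \<Longrightarrow> s \<noteq> t \<Longrightarrow> dist s t < d1 \<Longrightarrow> dist (f s) (f t) < 1"
      unfolding eventually_at by blast
    have "eventually (\<lambda>s. dist (f s) l < 1) (at t within {0..<t})"
      using l by (simp add: tendsto_iff)
    then obtain d2 where d2: "d2 > 0"
      "\<And>s. s \<in> {0..<t} \<Longrightarrow> s \<noteq> t \<Longrightarrow> dist s t < d2 \<Longrightarrow> dist (f s) l < 1"
      unfolding eventually_at by blast
    define U where "U = ball t (min d1 d2)"
    have "f ` (U \<inter> {0..T}) \<subseteq> cball (f t) 1 \<union> cball l 1"
    proof
      fix y assume "y \<in> f ` (U \<inter> {0..T})"
      then obtain s where s: "s \<in> {0..T}" "dist s t < d1" "dist s t < d2" "y = f s"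
        by (auto simp: U_def dist_commute)
      consider "s = t" | "s < t" | "t < s" by linarith
      then show "y \<in> cball (f t) 1 \<union> cball l 1"
      proof cases
        case 1 then show ?thesis using s by simp
      next
        case 2 then show ?thesis using s d2(2)[of s] by (auto simp: dist_commute less_imp_le)
      next
        case 3 then show ?thesis using s d1(2)[of s] by (auto simp: dist_commute less_imp_le)
      qed
    qed
    then have "bounded (f ` (U \<inter> {0..T}))"
      by (rule bounded_subset[rotated]) simp
    moreover have "open U" "t \<in> U" using d1 d2 by (auto simp: U_def)
    ultimately show ?thesis by blast
  qed
  then obtain U where U: "\<And>t. t \<in> {0..T} \<Longrightarrow> open (U t) \<and> t \<in> U t \<and> bounded (f ` (U t \<inter> {0..T}))"
    by metis
  have "\<exists>C\<subseteq>{0..T}. finite C \<and> {0..T} \<subseteq> (\<Union>t\<in>C. U t)"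
  proof (rule compactE_image[of "{0..T}" "{0..T}" U])
    show "{0..T} \<subseteq> \<Union> (U ` {0..T})" using U by blast
  qed (use U in auto)
  then obtain C where C: "C \<subseteq> {0..T}" "finite C" "{0..T} \<subseteq> (\<Union>t\<in>C. U t)" by blast
  have "bounded (\<Union>t\<in>C. f ` (U t \<inter> {0..T}))"
    using C U by (intro bounded_UN) auto
  moreover have "f ` {0..T} \<subseteq> (\<Union>t\<in>C. f ` (U t \<inter> {0..T}))" using C by blast
  ultimately show ?thesis by (rule bounded_subset)
qed

lemma skorokhod_bound_exists:
  fixes f g :: "real \<Rightarrow> 'b::metric_space"
  assumes "f \<in> cadlag_space T" "g \<in> cadlag_space T"
  shows "\<exists>e l. skorokhod_bound T f g l e"
proof -
  have "bounded (f ` {0..T} \<union> g ` {0..T})" using assms by (simp add: cadlag_bounded)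
  then obtain e where e: "\<And>x y. x \<in> f ` {0..T} \<union> g ` {0..T} \<Longrightarrow>
      y \<in> f ` {0..T} \<union> g ` {0..T} \<Longrightarrow> dist x y \<le> e"
    unfolding bounded_two_points by blast
  have "skorokhod_bound T f g (\<lambda>t. t) (max e 0)"
    using time_change_id e by (auto simp: skorokhod_bound_def le_max_iff_disj)
  then show ?thesis by blast
qed

lemma skorokhod_dist_le:
  assumes "0 \<le> T" "f \<in> cadlag_space T" "g \<in> cadlag_space T" "skorokhod_bound T f g l e"
  shows "skorokhod_dist T f g \<le> e"
  unfolding skorokhod_dist_eq[OF assms(2,3)]
proof (rule cInf_lower)
  show "e \<in> {e. \<exists>l. skorokhod_bound T f g l e}" using assms(4) by blast
  show "bdd_below {e. \<exists>l. skorokhod_bound T f g l e}"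
    by (rule bdd_belowI[of _ 0]) (use skorokhod_bound_nonneg[OF assms(1)] in blast)
qed

lemma skorokhod_dist_less:
  assumes "f \<in> cadlag_space T" "g \<in> cadlag_space T" "skorokhod_dist T f g < e"
  shows "\<exists>l d. d < e \<and> skorokhod_bound T f g l d"
proof -
  have "{e. \<exists>l. skorokhod_bound T f g l e} \<noteq> {}"
    using skorokhod_bound_exists[OF assms(1,2)] by auto
  from cInf_lessD[OF this, of e] show ?thesis
    using assms(3) unfolding skorokhod_dist_eq[OF assms(1,2)] by blast
qed

lemma skorokhod_dist_zero:
  fixes f g :: "real \<Rightarrow> 'b::metric_space"
  assumes T: "0 \<le> T" and f: "f \<in> cadlag_space T" and g: "g \<in> cadlag_space T"
    and z: "skorokhod_dist T f g = 0"
  shows "f = g"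
proof -
  have "\<exists>l d. d < e \<and> skorokhod_bound T f g l d" if "e > 0" for e
    using skorokhod_dist_less[OF f g] that z by auto
  then have approx: "\<exists>l\<in>time_changes T. \<forall>t\<in>{0..T}. \<bar>l t - t\<bar> < e \<and> dist (f t) (g (l t)) < e"
    if "e > 0" for e
    using that unfolding skorokhod_bound_def by (meson le_less_trans)
  have near: "\<exists>s\<in>{0..T}. \<bar>s - t\<bar> < e \<and> dist (f t) (g s) < e" if "e > 0" "t \<in> {0..T}" for e t
    using approx[OF that(1)] that(2) time_change_in by blast
  have fT: "f T = g T"
  proof (rule ccontr)
    assume "f T \<noteq> g T"
    then obtain l where "l \<in> time_changes T"
      "\<forall>t\<in>{0..T}. \<bar>l t - t\<bar> < dist (f T) (g T) \<and> dist (f t) (g (l t)) < dist (f T) (g T)"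
      using approx[of "dist (f T) (g T)"] by auto
    moreover from this have "l T = T" using time_change_end T by blast
    ultimately show False using T by (metis atLeastAtMost_iff less_irrefl order_refl)
  qed
  have "f t = g t" if t: "t \<in> {0..<T}" for t
  proof (rule ccontr)
    assume ne: "f t \<noteq> g t"
    define r where "r = dist (f t) (g t) / 4"
    have r: "r > 0" using ne by (simp add: r_def)
    have "eventually (\<lambda>s. dist (f s) (f t) < r) (at t within {t<..T})"
      using f t r by (auto simp: cadlag_space_def tendsto_iff)
    then obtain d1 where d1: "d1 > 0"
      "\<And>s. s \<in> {t<..T} \<Longrightarrow> s \<noteq> t \<Longrightarrow> dist s t < d1 \<Longrightarrow> dist (f s) (f t) < r"
      unfolding eventually_at by blast
    have "eventually (\<lambda>s. dist (g s) (g t) < r) (at t within {t<..T})"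
      using g t r by (auto simp: cadlag_space_def tendsto_iff)
    then obtain d2 where d2: "d2 > 0"
      "\<And>s. s \<in> {t<..T} \<Longrightarrow> s \<noteq> t \<Longrightarrow> dist s t < d2 \<Longrightarrow> dist (g s) (g t) < r"
      unfolding eventually_at by blast
    define m where "m = min (min d1 d2) (T - t)"
    have m: "m > 0" "m \<le> d1" "m \<le> d2" "m \<le> T - t" using d1 d2 t by (auto simp: m_def)
    define s where "s = t + m / 2"
    have s: "s \<in> {0..T}" "s \<in> {t<..T}" "dist s t < d1" "s \<noteq> t"
      using m t by (auto simp: s_def dist_real_def)
    obtain u where u: "u \<in> {0..T}" "\<bar>u - s\<bar> < min r (m / 2)" "dist (f s) (g u) < min r (m / 2)"
      using near[of "min r (m / 2)" s] s r m by auto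
    have "t < u" "u - t < m" using u m unfolding s_def abs_less_iff by (simp_all add: field_simps)
    then have "u \<in> {t<..T}" "dist u t < d2" "u \<noteq> t"
      using u m by (auto simp: dist_real_def)
    then have "dist (g u) (g t) < r" using d2(2) by blast
    moreover have "dist (f s) (f t) < r" using d1(2) s by blast
    moreover have "dist (f s) (g u) < r" using u by simp
    ultimately have "dist (f t) (g t) < 3 * r"
      using dist_triangle[of "f t" "g t" "f s"] dist_triangle[of "f s" "g t" "g u"]
      by (simp add: dist_commute)
    then show False using r by (simp add: r_def)
  qed
  then have "f t = g t" if "t \<in> {0..T}" for t using fT that by (cases "t = T") auto
  then show ?thesis using f g by (intro extensionalityI[of f "{0..T}" g]) (auto simp: cadlag_space_def)
qed

lemma Metric_space_skorokhod:
  assumes T: "0 \<le> T"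
  shows "Metric_space (cadlag_space T :: (real \<Rightarrow> 'b::metric_space) set) (skorokhod_dist T)"
proof
  fix f g h :: "real \<Rightarrow> 'b"
  show "0 \<le> skorokhod_dist T f g"
  proof (cases "f \<in> cadlag_space T \<and> g \<in> cadlag_space T")
    case False
    then show ?thesis unfolding skorokhod_dist_def by (simp only: if_False order_refl)
  next
    case True
    then have fg: "f \<in> cadlag_space T" "g \<in> cadlag_space T" by auto
    show ?thesis unfolding skorokhod_dist_eq[OF fg]
      using skorokhod_bound_exists[OF fg] skorokhod_bound_nonneg[OF T]
      by (intro cInf_greatest) auto
  qed
  show "skorokhod_dist T f g = skorokhod_dist T g f"
  proof (cases "f \<in> cadlag_space T \<and> g \<in> cadlag_space T")
    case True
    then have fg: "f \<in> cadlag_space T" "g \<in> cadlag_space T" by auto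
    have "{e. \<exists>l. skorokhod_bound T f g l e} = {e. \<exists>l. skorokhod_bound T g f l e}"
      using skorokhod_bound_inv by blast
    then show ?thesis by (simp add: skorokhod_dist_eq fg)
  qed (auto simp: skorokhod_dist_def)
  assume f: "f \<in> cadlag_space T" and g: "g \<in> cadlag_space T"
  show "(skorokhod_dist T f g = 0) = (f = g)"
  proof
    assume "f = g"
    then have "skorokhod_bound T f g (\<lambda>t. t) 0"
      by (simp add: skorokhod_bound_def time_change_id)
    from skorokhod_dist_le[OF T f g this] show "skorokhod_dist T f g = 0"
      using \<open>0 \<le> skorokhod_dist T f g\<close> by simp
  qed (use skorokhod_dist_zero[OF T f g] in simp)
  assume h: "h \<in> cadlag_space T"
  show "skorokhod_dist T f h \<le> skorokhod_dist T f g + skorokhod_dist T g h"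
  proof (rule field_le_epsilon)
    fix e :: real assume e: "e > 0"
    obtain l d where 1: "d < skorokhod_dist T f g + e / 2" "skorokhod_bound T f g l d"
      using skorokhod_dist_less[OF f g, of "skorokhod_dist T f g + e / 2"] e by auto
    obtain k d' where 2: "d' < skorokhod_dist T g h + e / 2" "skorokhod_bound T g h k d'"
      using skorokhod_dist_less[OF g h, of "skorokhod_dist T g h + e / 2"] e by auto
    have "skorokhod_dist T f h \<le> d + d'"
      using skorokhod_dist_le[OF T f h skorokhod_bound_comp[OF 1(2) 2(2)]] .
    then show "skorokhod_dist T f h \<le> skorokhod_dist T f g + skorokhod_dist T g h + e"
      using 1(1) 2(1) by linarith
  qed
qed

lemma topspace_skorokhod: "0 \<le> T \<Longrightarrow> topspace (skorokhod_topology T) = cadlag_space T"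
  unfolding skorokhod_topology_def
  by (rule Metric_space.topspace_mtopology[OF Metric_space_skorokhod])


section \<open>Convergence in distribution\<close>

definition converges_in_distribution ::
  "'s topology \<Rightarrow> ('i \<Rightarrow> 'a measure) \<Rightarrow> ('i \<Rightarrow> 'a \<Rightarrow> 's) \<Rightarrow> 'c measure \<Rightarrow> ('c \<Rightarrow> 's) \<Rightarrow> 'i filter \<Rightarrow> bool"
  where
  "converges_in_distribution S M X M' X' F \<longleftrightarrow>
     (\<forall>f. continuous_map S euclideanreal f \<and> bounded (f ` topspace S) \<longrightarrow>
        ((\<lambda>i. \<integral>\<omega>. f (X i \<omega>) \<partial>M i) \<longlongrightarrow> (\<integral>\<omega>. f (X' \<omega>) \<partial>M')) F)"


section \<open>The agent-based model\<close>

text \<open>A realisation, on an arbitrary probability space, of the discrete-time Markov chain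
  started at \<open>x0\<close> with transition kernel \<open>K\<close>. All laws \<open>K x\<close> being discrete, the chain is almost
  surely in a countable set at each step, so that conditioning on the exact past determines its
  law.\<close>

definition markov_chain ::
  "'a measure \<Rightarrow> (nat \<Rightarrow> 'a \<Rightarrow> 'b::topological_space) \<Rightarrow> ('b \<Rightarrow> 'b pmf) \<Rightarrow> 'b \<Rightarrow> bool" where
  "markov_chain M X K x0 \<longleftrightarrow>
     prob_space M \<and>
     (\<forall>k. X k \<in> borel_measurable M) \<and>
     (AE \<omega> in M. X 0 \<omega> = x0) \<and>
     (\<forall>k y. \<P>(\<omega> in M. \<forall>l\<le>k. X l \<omega> = y l) \<noteq> 0 \<longrightarrow>
        \<P>(\<omega> in M. X (Suc k) \<omega> = y (Suc k) \<bar> \<forall>l\<le>k. X l \<omega> = y l) = pmf (K (y k)) (y (Suc k)))"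

definition select_prob ::
  "('n::finite \<Rightarrow> 'n \<Rightarrow> real^'n \<Rightarrow> real) \<Rightarrow> 'n \<Rightarrow> real^'n \<Rightarrow> 'n \<Rightarrow> real" where
  "select_prob p i x j = p i j x / (\<Sum>l\<in>UNIV. p i l x)"

definition interact :: "real \<Rightarrow> 'n::finite \<Rightarrow> 'n \<Rightarrow> real^'n \<Rightarrow> real^'n" where
  "interact \<mu> i j x = (\<chi> k. if k = i then x $ i + \<mu> * (x $ j - x $ i) else x $ k)"

definition abm_kernel ::
  "('n::finite \<Rightarrow> 'n \<Rightarrow> real^'n \<Rightarrow> real) \<Rightarrow> real \<Rightarrow> real^'n \<Rightarrow> (real^'n) pmf" where
  "abm_kernel p \<mu> x =
     bind_pmf (pmf_of_set UNIV) (\<lambda>i.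
       map_pmf (\<lambda>j. interact \<mu> i j x) (embed_pmf (select_prob p i x)))"

text \<open>\<^const>\<open>embed_pmf\<close> is meaningful only for genuine probability weights:\<close>

lemma pmf_select_prob:
  assumes "\<And>j. 0 \<le> p i j x" "(\<Sum>l\<in>UNIV. p i l x) > 0"
  shows "pmf (embed_pmf (select_prob p i x)) j = select_prob p i x j"
proof (rule pmf_embed_pmf)
  show nn: "0 \<le> select_prob p i x j" for j
    using assms by (simp add: select_prob_def)
  have "(\<Sum>j\<in>UNIV. select_prob p i x j) = 1"
    using assms by (simp add: select_prob_def flip: sum_divide_distrib)
  then show "(\<integral>\<^sup>+ j. ennreal (select_prob p i x j) \<partial>count_space UNIV) = 1"
    using nn by (simp add: nn_integral_count_space_finite sum_ennreal)
qed

text \<open>\<open>x k\<close> is the state at time \<open>k * h\<close>.\<close>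

definition trajectory :: "real \<Rightarrow> real \<Rightarrow> (nat \<Rightarrow> 'b) \<Rightarrow> real \<Rightarrow> 'b" where
  "trajectory T h x = (\<lambda>t\<in>{0..T}. x (nat \<lfloor>t / h\<rfloor>))"

lemma trajectory_cadlag:
  fixes x :: "nat \<Rightarrow> 'b::metric_space"
  assumes h: "h > 0"
  shows "trajectory T h x \<in> cadlag_space T"
proof -
  have "(trajectory T h x \<longlongrightarrow> trajectory T h x t) (at t within {t<..T})" if t: "t \<in> {0..T}" for t
  proof (rule tendsto_eventually)
    define d where "d = h * (\<lfloor>t / h\<rfloor> + 1) - t"
    have "t / h < \<lfloor>t / h\<rfloor> + 1" by linarith
    then have d: "d > 0" using h by (simp add: d_def field_simps)
    have "trajectory T h x s = trajectory T h x t" if s: "s \<in> {t<..T}" "dist s t < d" for s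
    proof -
      have "s / h < \<lfloor>t / h\<rfloor> + 1" "t / h \<le> s / h"
        using s h by (auto simp: d_def dist_real_def field_simps)
      then have "\<lfloor>s / h\<rfloor> = \<lfloor>t / h\<rfloor>" by linarith
      then show ?thesis using s t by (simp add: trajectory_def)
    qed
    then show "\<forall>\<^sub>F s in at t within {t<..T}. trajectory T h x s = trajectory T h x t"
      unfolding eventually_at using d by blast
  qed
  moreover have "\<exists>l. (trajectory T h x \<longlongrightarrow> l) (at t within {0..<t})" if t: "t \<in> {0..T}" for t
  proof
    define n where "n = \<lceil>t / h\<rceil> - 1"
    have "t / h > n" unfolding n_def by linarith
    then have d: "t - h * n > 0" using h by (simp add: field_simps)
    show "(trajectory T h x \<longlongrightarrow> x (nat n)) (at t within {0..<t})"
    proof (rule tendsto_eventually)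
      have "trajectory T h x s = x (nat n)" if s: "s \<in> {0..<t}" "dist s t < t - h * n" for s
      proof -
        have "s / h < t / h" "n \<le> s / h"
          using s h by (auto simp: dist_real_def field_simps)
        then have "\<lfloor>s / h\<rfloor> = n" unfolding n_def by linarith
        then show ?thesis using s t by (simp add: trajectory_def)
      qed
      then show "\<forall>\<^sub>F s in at t within {0..<t}. trajectory T h x s = x (nat n)"
        unfolding eventually_at using d by blast
    qed
  qed
  ultimately show ?thesis by (simp add: cadlag_space_def trajectory_def)
qed

text \<open>Trajectories are random elements of the Skorokhod space: preimages of open sets are
  events.\<close>

lemma trajectory_random_element:
  fixes X :: "nat \<Rightarrow> 'a \<Rightarrow> 'b::{metric_space, second_countable_topology}"
  assumes T: "0 \<le> T" and h: "h > 0" and X: "\<And>k. X k \<in> borel_measurable M"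
    and U: "openin (skorokhod_topology T) U"
  shows "{\<omega> \<in> space M. trajectory T h (\<lambda>k. X k \<omega>) \<in> U} \<in> sets M"
proof -
  interpret S: Metric_space "cadlag_space T :: (real \<Rightarrow> 'b) set" "skorokhod_dist T"
    using T by (rule Metric_space_skorokhod)
  define V where "V = {y :: nat \<Rightarrow> 'b. trajectory T h y \<in> U}"
  define K where "K = nat \<lfloor>T / h\<rfloor>"
  have "open V"
  proof (rule Topological_Spaces.openI)
    fix y assume "y \<in> V"
    then obtain r where r: "r > 0" "S.mball (trajectory T h y) r \<subseteq> U"
      using U unfolding V_def skorokhod_topology_def S.openin_mtopology by blast
    define W where "W = Pi\<^sub>E UNIV (\<lambda>k. if k \<le> K then ball (y k) (r / 2) else UNIV)"
    have fin: "finite {k. (if k \<le> K then ball (y k) (r / 2) else UNIV) \<noteq> UNIV}"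
      by (rule finite_subset[of _ "{..K}"]) (auto split: if_splits)
    have "open W" unfolding W_def by (intro open_PiE fin) simp
    moreover have "y \<in> W" using r by (auto simp: W_def)
    moreover have "W \<subseteq> V"
    proof
      fix z assume z: "z \<in> W"
      have zb: "dist (y k) (z k) < r / 2" if "k \<le> K" for k
      proof -
        have "z k \<in> (if k \<le> K then ball (y k) (r / 2) else UNIV)"
          using z unfolding W_def by (rule PiE_mem) simp
        then show ?thesis using that by simp
      qed
      have "nat \<lfloor>t / h\<rfloor> \<le> K" if "t \<in> {0..T}" for t
        using that h unfolding K_def by (intro nat_mono floor_mono divide_right_mono) auto
      then have "skorokhod_bound T (trajectory T h y) (trajectory T h z) (\<lambda>t. t) (r / 2)"
        using zb r by (auto simp: skorokhod_bound_def time_change_id trajectory_def intro: less_imp_le)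
      from skorokhod_dist_le[OF T trajectory_cadlag[OF h] trajectory_cadlag[OF h] this]
      have "trajectory T h z \<in> S.mball (trajectory T h y) r"
        using r trajectory_cadlag[OF h] by auto
      then show "z \<in> V" using r by (auto simp: V_def)
    qed
    ultimately show "\<exists>W. open W \<and> y \<in> W \<and> W \<subseteq> V" by blast
  qed
  moreover have "(\<lambda>\<omega> k. X k \<omega>) \<in> borel_measurable M"
    using X by (intro measurable_coordinatewise_then_product)
  ultimately have "(\<lambda>\<omega> k. X k \<omega>) -` V \<inter> space M \<in> sets M"
    using measurable_sets[OF _ borel_open] by blast
  moreover have "(\<lambda>\<omega> k. X k \<omega>) -` V \<inter> space M =
      {\<omega> \<in> space M. trajectory T h (\<lambda>k. X k \<omega>) \<in> U}"
    by (auto simp: V_def)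
  ultimately show ?thesis by simp
qed


section \<open>The limiting differential equation\<close>

definition drift :: "('n::finite \<Rightarrow> 'n \<Rightarrow> real^'n \<Rightarrow> real) \<Rightarrow> real^'n \<Rightarrow> real^'n" where
  "drift p x = (\<chi> i. inverse (\<Sum>l\<in>UNIV. p i l x) * (\<Sum>j\<in>UNIV. p i j x * (x $ j - x $ i)))"

definition solves_ivp ::
  "real \<Rightarrow> ('b::real_normed_vector \<Rightarrow> 'b) \<Rightarrow> 'b \<Rightarrow> (real \<Rightarrow> 'b) \<Rightarrow> bool" where
  "solves_ivp T b x0 X \<longleftrightarrow>
     X 0 = x0 \<and> (\<forall>t\<in>{0..T}. (X has_vector_derivative b (X t)) (at t within {0..T}))"

end

theory Submission
  imports Defs
begin

text \<open>The expected increment of the chain in one step is \<open>h\<close> times the drift, and all increments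
  are \<open>O(h)\<close> because opinions stay in the box spanned by the initial ones, where the drift is
  Lipschitz. Expanding the square, \<open>E |x(t+h) - X(t+h)|\<^sup>2 \<le> (1 + O(h)) E |x(t) - X(t)|\<^sup>2 + O(h\<^sup>2)\<close>,
  so the mean square error at any fixed time is \<open>O(h)\<close> by Gronwall's inequality. No maximal
  inequality is needed: chain and solution both move at bounded speed, so closeness on
  a finite time grid, independent of \<open>h\<close>, forces uniform closeness, and uniform closeness bounds
  the Skorokhod distance. Convergence in probability to a constant gives convergence in
  distribution.\<close>

section \<open>Initial value problems\<close>

text \<open>The obstacle is that the drift, while Lipschitz on bounded sets, need not be globally
  Lipschitz: its Lipschitz weights multiply unbounded opinions. Both the existence of the solution
  and the error estimate therefore rely on a box that neither chain nor solution leaves; for the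
  chain this holds once \<open>N h \<le> 1\<close>. An individual is chosen with probability
  \<open>1 / N\<close>, which the update distance \<open>N h\<close> compensates exactly. After
  averaging, the cross term in the expanded square keeps only the difference of drifts and the Euler
  error of the solution, so \<open>T / h\<close> steps, each adding O(h^2), leave O(h). The chains
  for different \<open>h\<close> live on unrelated probability spaces, and their Markov property
  speaks only of exact paths. Two consequences are drawn from it: the law at a fixed time is the
  iterated kernel, and almost surely every step stays in the support of the kernel. Moments are then
  computed for a \<open>pmf\<close>, and the union bound over the grid uses laws at single times
  only.\<close>

lemma picard_lindelof_lipschitz:
  fixes f :: "'b::{banach, heine_borel} \<Rightarrow> 'b"
  assumes f: "L-lipschitz_on UNIV f" and T: "0 \<le> T"
  shows "\<exists>X. solves_ivp T f x0 X"
proof -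
  \<comment> \<open>Banach's theorem for \<open>u(t) = exp (- K t) X(t)\<close>: the weight makes the Picard map a
    contraction with constant \<open>L / K < 1\<close> on all of \<open>[0,T]\<close>.\<close>
  define K where "K = L + 1"
  have L: "0 \<le> L" using f by (rule lipschitz_on_nonneg)
  then have K: "0 < K" by (simp add: K_def)
  \<comment> \<open>Clamping time to \<open>[0,T]\<close> turns functions on the interval into
    bounded continuous functions on the whole line, a complete type to which the fixed point theorem
    applies.\<close>
  define \<tau> where "\<tau> t = max 0 (min T t)" for t :: real
  have \<tau>: "\<tau> t \<in> {0..T}" "t \<in> {0..T} \<Longrightarrow> \<tau> t = t" for t using T by (auto simp: \<tau>_def)
  define G where "G u s = f (exp (K * s) *\<^sub>R u s)" for u :: "real \<Rightarrow> 'b" and s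
  define P where "P u t = x0 + integral {0..t} (G u)" for u :: "real \<Rightarrow> 'b" and t
  have G_cont: "continuous_on S (G u)" if "continuous_on UNIV u" for u S
    unfolding G_def
    by (intro continuous_on_compose2[OF lipschitz_on_continuous_on[OF f]] continuous_intros
          continuous_on_subset[OF that]) auto
  have G_int: "G (apply_bcontfun u) integrable_on {a..b}" for u :: "real \<Rightarrow>\<^sub>C 'b" and a b
    by (intro integrable_continuous_real G_cont) simp
  have P_cont: "continuous_on {0..T} (P (apply_bcontfun u))" for u :: "real \<Rightarrow>\<^sub>C 'b"
    unfolding P_def by (intro continuous_intros indefinite_integral_continuous_1 G_int)
  define H where "H u t = exp (- K * \<tau> t) *\<^sub>R P (apply_bcontfun u) (\<tau> t)" for u :: "real \<Rightarrow>\<^sub>C 'b" and t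
  have H_bcont: "H u \<in> bcontfun" for u
  proof -
    have c: "continuous_on {0..T} (\<lambda>t. exp (- K * t) *\<^sub>R P (apply_bcontfun u) t)"
      by (intro continuous_intros P_cont)
    have "range (H u) \<subseteq> (\<lambda>t. exp (- K * t) *\<^sub>R P (apply_bcontfun u) t) ` {0..T}"
      using \<tau> by (auto simp: H_def)
    moreover have "bounded ((\<lambda>t. exp (- K * t) *\<^sub>R P (apply_bcontfun u) t) ` {0..T})"
      using compact_continuous_image[OF c] compact_imp_bounded by auto
    ultimately have "bounded (range (H u))" using bounded_subset by blast
    moreover have "continuous_on UNIV (H u)" unfolding H_def
      by (rule continuous_on_compose2[OF c]) (use \<tau> in \<open>auto simp: \<tau>_def intro!: continuous_intros\<close>)
    ultimately show ?thesis by (simp add: bcontfun_def)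
  qed
  define F where "F u = Bcontfun (H u)" for u
  have F: "apply_bcontfun (F u) = H u" for u
    using H_bcont by (simp add: F_def Bcontfun_inverse)
  have "dist (F u) (F v) \<le> L / K * dist u v" for u v
  proof (rule dist_bound)
    fix t
    define d where "d = dist u v"
    have d: "norm (apply_bcontfun u s - apply_bcontfun v s) \<le> d" for s
      using dist_bounded[of u s v] by (simp add: d_def dist_norm)
    have G_diff: "norm (G (apply_bcontfun u) s - G (apply_bcontfun v) s) \<le> L * d * exp (K * s)" for s
    proof -
      have "norm (G (apply_bcontfun u) s - G (apply_bcontfun v) s)
          \<le> L * norm (exp (K * s) *\<^sub>R apply_bcontfun u s - exp (K * s) *\<^sub>R apply_bcontfun v s)"
        unfolding G_def by (rule lipschitz_on_normD[OF f]) auto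
      also have "\<dots> = L * (exp (K * s) * norm (apply_bcontfun u s - apply_bcontfun v s))"
        by (simp flip: scaleR_diff_right)
      also have "\<dots> \<le> L * (exp (K * s) * d)"
        using L d by (intro mult_left_mono) auto
      finally show ?thesis by (simp add: mult_ac)
    qed
    \<comment> \<open>Integrating \<open>exp (K * s)\<close> gains the factor \<open>1 / K\<close>;
      the weight \<open>exp (- K * t)\<close> then cancels the growth that remains.\<close>
    have e: "((\<lambda>s. L * d * exp (K * s)) has_integral
        L * d / K * exp (K * \<tau> t) - L * d / K * exp (K * 0)) {0..\<tau> t}"
      using \<tau>[of t] K
      by (intro fundamental_theorem_of_calculus)
         (auto intro!: derivative_eq_intros simp: has_real_derivative_iff_has_vector_derivative[symmetric])
    have "norm (P (apply_bcontfun u) (\<tau> t) - P (apply_bcontfun v) (\<tau> t))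
        = norm (integral {0..\<tau> t} (\<lambda>s. G (apply_bcontfun u) s - G (apply_bcontfun v) s))"
      by (simp add: P_def integral_diff G_int)
    also have "\<dots> \<le> integral {0..\<tau> t} (\<lambda>s. L * d * exp (K * s))"
      using G_diff e by (intro integral_norm_bound_integral integrable_diff G_int) auto
    also have "\<dots> = L * d / K * exp (K * \<tau> t) - L * d / K"
      using integral_unique[OF e] by simp
    also have "\<dots> \<le> L * d / K * exp (K * \<tau> t)"
      using L K by (simp add: d_def)
    finally have "exp (- K * \<tau> t) * norm (P (apply_bcontfun u) (\<tau> t) - P (apply_bcontfun v) (\<tau> t))
        \<le> exp (- K * \<tau> t) * (L * d / K * exp (K * \<tau> t))"
      by (intro mult_left_mono) auto
    also have "\<dots> = L / K * d" by (simp add: exp_minus field_simps)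
    finally show "dist (apply_bcontfun (F u) t) (apply_bcontfun (F v) t) \<le> L / K * dist u v"
      by (simp add: F H_def dist_norm d_def flip: scaleR_diff_right)
  qed
  then have "\<exists>!u. F u = u"
    using L by (intro banach_fix_type[of "L / K"]) (auto simp: K_def)
  then obtain u where u: "F u = u" by blast
  define X where "X = P (apply_bcontfun u)"
  have X: "X t = exp (K * t) *\<^sub>R apply_bcontfun u t" if "t \<in> {0..T}" for t
  proof -
    have "apply_bcontfun u t = H u t" using F[of u] u by simp
    then show ?thesis using \<tau>(2)[OF that] by (simp add: X_def H_def flip: exp_add)
  qed
  have "(X has_vector_derivative f (X t)) (at t within {0..T})" if t: "t \<in> {0..T}" for t
  proof -
    have "(X has_vector_derivative 0 + G (apply_bcontfun u) t) (at t within {0..T})"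
      unfolding X_def P_def using t G_cont
      by (intro has_vector_derivative_add has_vector_derivative_const integral_has_vector_derivative) auto
    then show ?thesis using X[OF t] by (simp add: G_def)
  qed
  moreover have "X 0 = x0" by (simp add: X_def P_def)
  ultimately show ?thesis unfolding solves_ivp_def by blast
qed

lemma solves_ivp_continuous_on: "solves_ivp T b x0 X \<Longrightarrow> continuous_on {0..T} X"
  unfolding solves_ivp_def continuous_on_eq_continuous_within
  using has_vector_derivative_continuous by blast

text \<open>Gronwall with an integrating factor: \<open>exp (- 2 * L * s)\<close> times the squared
  distance of the two solutions vanishes at 0 and cannot increase. The constant \<open>L\<close> is
  taken on the union of their ranges, which is bounded by compactness.\<close>

lemma solves_ivp_unique:
  fixes b :: "'b::euclidean_space \<Rightarrow> 'b"
  assumes X: "solves_ivp T b x0 X" and Y: "solves_ivp T b x0 Y"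
    and lip: "\<And>B. bounded B \<Longrightarrow> \<exists>L. L-lipschitz_on B b"
    and t: "t \<in> {0..T}"
  shows "Y t = X t"
proof -
  have "bounded (X ` {0..T})" "bounded (Y ` {0..T})"
    using assms(1,2)[THEN solves_ivp_continuous_on] compact_imp_bounded compact_continuous_image
      compact_Icc by blast+
  then have "bounded (X ` {0..T} \<union> Y ` {0..T})" by simp
  then obtain L where L: "L-lipschitz_on (X ` {0..T} \<union> Y ` {0..T}) b" using lip by blast
  define v where "v s = Y s - X s" for s
  define w where "w s = b (Y s) - b (X s)" for s
  define u where "u s = exp (- 2 * L * s) * (v s \<bullet> v s)" for s
  have v: "(v has_vector_derivative w s) (at s within {0..T})" if "s \<in> {0..T}" for s
    using X Y that unfolding v_def w_def solves_ivp_def by (intro has_vector_derivative_diff) auto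
  have u: "(u has_real_derivative exp (- 2 * L * s) * (2 * (v s \<bullet> w s) - 2 * L * (v s \<bullet> v s)))
      (at s within {0..T})" if "s \<in> {0..T}" for s
    unfolding u_def has_real_derivative_iff_has_vector_derivative
    using v[OF that]
    by (auto intro!: derivative_eq_intros simp: has_vector_derivative_def fun_eq_iff
        inner_commute algebra_simps)
  have neg: "exp (- 2 * L * s) * (2 * (v s \<bullet> w s) - 2 * L * (v s \<bullet> v s)) \<le> 0" if s: "s \<in> {0..T}" for s
  proof -
    have "v s \<bullet> w s \<le> norm (v s) * norm (w s)" by (rule norm_cauchy_schwarz)
    also have "\<dots> \<le> norm (v s) * (L * norm (v s))"
      unfolding v_def w_def using s by (intro mult_left_mono lipschitz_on_normD[OF L]) auto
    also have "\<dots> = L * (v s \<bullet> v s)" by (simp add: dot_square_norm power2_eq_square)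
    finally show ?thesis by (intro mult_nonneg_nonpos) auto
  qed
  have "u t \<le> u 0"
  proof (rule DERIV_nonpos_imp_decreasing_open[of 0 t u])
    have "continuous_on {0..T} u"
      unfolding continuous_on_eq_continuous_within using u DERIV_continuous by blast
    then show "continuous_on {0..t} u" by (rule continuous_on_subset) (use t in auto)
    fix s assume s: "0 < s" "s < t"
    then have "at s within {0..T} = at s" using t by (intro at_within_interior) auto
    then show "\<exists>y. (u has_real_derivative y) (at s) \<and> y \<le> 0"
      using u[of s] neg[of s] s t by auto
  qed (use t in auto)
  also have "u 0 = 0" using X Y by (simp add: u_def v_def solves_ivp_def)
  finally have "v t \<bullet> v t \<le> 0" by (simp add: u_def mult_le_0_iff)
  then have "v t = 0" using inner_gt_zero_iff[of "v t"] by linarith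
  then show ?thesis by (simp add: v_def)
qed

section \<open>Markov chains with finitely supported kernels\<close>

text \<open>The law at a fixed time as a \<open>pmf\<close>, detached from the probability space
  that carries the chain; for finitely supported kernels its expectations are finite sums.\<close>

primrec chain_law :: "('b \<Rightarrow> 'b pmf) \<Rightarrow> 'b \<Rightarrow> nat \<Rightarrow> 'b pmf" where
  "chain_law K x0 0 = return_pmf x0"
| "chain_law K x0 (Suc k) = bind_pmf (chain_law K x0 k) K"

text \<open>Finite supports leave finitely many paths of each length up to null sets, so a Markov
  property about single paths can be summed. In a T1 space singletons are closed, which makes
  \<open>X k = z\<close> an event.\<close>

locale finite_markov_chain =
  fixes M :: "'a measure" and X :: "nat \<Rightarrow> 'a \<Rightarrow> 'b::t1_space"
    and K :: "'b \<Rightarrow> 'b pmf" and x0 :: 'b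
  assumes chain: "markov_chain M X K x0"
    and finite_kernel: "\<And>y. finite (set_pmf (K y))"
begin

sublocale prob_space M
  using chain by (simp add: markov_chain_def)

lemma X_measurable [measurable]: "X k \<in> borel_measurable M"
  using chain by (simp add: markov_chain_def)

abbreviation "past k y \<omega> \<equiv> \<forall>l\<le>k. X l \<omega> = y l"

lemma measurable_state_eq [measurable]: "Measurable.pred M (\<lambda>\<omega>. X k \<omega> = z)"
proof -
  have "X k -` {z} \<inter> space M \<in> events"
    using X_measurable[of k] by (rule measurable_sets) (simp add: borel_closed)
  also have "X k -` {z} \<inter> space M = {\<omega> \<in> space M. X k \<omega> = z}" by auto
  finally show ?thesis by (simp add: pred_def)
qed

lemma finite_chain_law: "finite (set_pmf (chain_law K x0 k))"
  by (induction k) (auto simp: finite_kernel)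

lemma AE_start: "AE \<omega> in M. X 0 \<omega> = x0"
  using chain by (simp add: markov_chain_def)

text \<open>The product form covers pasts of probability zero too, about which the conditional
  statement says nothing: there both sides vanish.\<close>

lemma prob_step:
  "prob {\<omega> \<in> space M. past k y \<omega> \<and> X (Suc k) \<omega> = z} = prob {\<omega> \<in> space M. past k y \<omega>} * pmf (K (y k)) z"
proof (cases "prob {\<omega> \<in> space M. past k y \<omega>} = 0")
  case True
  have "prob {\<omega> \<in> space M. past k y \<omega> \<and> X (Suc k) \<omega> = z} \<le> prob {\<omega> \<in> space M. past k y \<omega>}"
    by (intro finite_measure_mono) auto
  with True show ?thesis by (simp add: measure_le_0_iff)
next
  case False
  \<comment> \<open>\<open>markov_chain\<close> reads the past and the next state off one sequence.
    Overwriting the entry at \<open>Suc k\<close> by \<open>z\<close> leaves the past up to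
    \<open>k\<close> unchanged.\<close>
  define y' where "y' = y(Suc k := z)"
  have p: "past k y' \<omega> \<longleftrightarrow> past k y \<omega>" for \<omega> by (auto simp: y'_def)
  have "cond_prob M (\<lambda>\<omega>. X (Suc k) \<omega> = y' (Suc k)) (past k y') = pmf (K (y' k)) (y' (Suc k))"
    using chain False unfolding markov_chain_def p[symmetric] by blast
  then have "cond_prob M (\<lambda>\<omega>. X (Suc k) \<omega> = z) (past k y) = pmf (K (y k)) z"
    unfolding p by (simp add: y'_def)
  then show ?thesis using False by (simp add: cond_prob_def field_simps conj_commute)
qed

text \<open>For a fixed past, the transition probabilities over the finite support of the kernel sum
  to one, so leaving the support is a null event. The two claims feed each other: support up to time
  \<open>k\<close> leaves finitely many pasts, whose null events can be united, and this gives
  support at \<open>Suc k\<close>.\<close>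

lemma AE_support:
  "AE \<omega> in M. \<forall>l\<le>k. X l \<omega> \<in> set_pmf (chain_law K x0 l)"
  "AE \<omega> in M. X (Suc k) \<omega> \<in> set_pmf (K (X k \<omega>))"
proof -
  define P where "P k = PiE {..k} (\<lambda>l. set_pmf (chain_law K x0 l))" for k :: nat
  have finP: "finite (P k)" for k unfolding P_def by (intro finite_PiE finite_chain_law) auto
  have step: "AE \<omega> in M. X (Suc k) \<omega> \<in> set_pmf (K (X k \<omega>))"
    if A: "AE \<omega> in M. \<forall>l\<le>k. X l \<omega> \<in> set_pmf (chain_law K x0 l)" for k
  proof -
    have "AE \<omega> in M. past k y \<omega> \<longrightarrow> X (Suc k) \<omega> \<in> set_pmf (K (y k))" for y
    proof -
      let ?F = "set_pmf (K (y k))"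
      let ?E = "{\<omega> \<in> space M. past k y \<omega>}"
      let ?D = "{\<omega> \<in> space M. past k y \<omega> \<and> X (Suc k) \<omega> \<in> ?F}"
      have unique: "(\<forall>z\<in>F. P \<and> a = z \<longrightarrow> P \<and> a \<in> F) \<and> (P \<and> a \<in> F \<longrightarrow> (\<exists>!z\<in>F. P \<and> a = z))"
        for P and a :: 'b and F by auto
      have "(\<Union>z\<in>?F. {\<omega> \<in> space M. past k y \<omega> \<and> X (Suc k) \<omega> = z}) \<in> events"
        by (intro sets.finite_UN finite_kernel) measurable
      also have "(\<Union>z\<in>?F. {\<omega> \<in> space M. past k y \<omega> \<and> X (Suc k) \<omega> = z}) = ?D" by auto
      finally have D: "?D \<in> events" .
      have "prob ?D = (\<Sum>z\<in>?F. prob {\<omega> \<in> space M. past k y \<omega> \<and> X (Suc k) \<omega> = z})"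
      proof (rule prob_sum)
        show "AE \<omega> in M. (\<forall>z\<in>?F. past k y \<omega> \<and> X (Suc k) \<omega> = z \<longrightarrow> past k y \<omega> \<and> X (Suc k) \<omega> \<in> ?F) \<and>
          (past k y \<omega> \<and> X (Suc k) \<omega> \<in> ?F \<longrightarrow> (\<exists>!z\<in>?F. past k y \<omega> \<and> X (Suc k) \<omega> = z))"
          by (intro AE_I2 unique)
        show "{\<omega> \<in> space M. past k y \<omega> \<and> X (Suc k) \<omega> = z} \<in> events" for z by measurable
      qed (fact D finite_kernel)+
      also have "\<dots> = prob ?E * (\<Sum>z\<in>?F. pmf (K (y k)) z)"
        unfolding prob_step by (simp add: sum_distrib_left)
      also have "\<dots> = prob ?E"
        using finite_kernel[of "y k"] by (simp add: sum_pmf_eq_1)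
      finally have "prob ?D = prob ?E" .
      moreover have E: "?E \<in> events" by measurable
      moreover have "?D \<subseteq> ?E" by blast
      ultimately have "prob (?E - ?D) = 0" using finite_measure_Diff[OF E D] by (simp only: diff_self)
      then have "AE \<omega> in M. \<omega> \<notin> ?E - ?D"
        using prob_eq_0[OF sets.Diff[OF E D]] by blast
      then show ?thesis
        by (rule AE_mp) (intro AE_I2, blast)
    qed
    then have "AE \<omega> in M. \<forall>y\<in>P k. past k y \<omega> \<longrightarrow> X (Suc k) \<omega> \<in> set_pmf (K (y k))"
      using finP by (intro AE_finite_allI) auto
    with A show ?thesis
    proof eventually_elim
      fix \<omega> assume a: "\<forall>l\<le>k. X l \<omega> \<in> set_pmf (chain_law K x0 l)"
        and b: "\<forall>y\<in>P k. past k y \<omega> \<longrightarrow> X (Suc k) \<omega> \<in> set_pmf (K (y k))"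
      \<comment> \<open>Restriction makes the observed past one of the finitely many extensional
        paths in \<open>P k\<close>.\<close>
      have "(\<lambda>l\<in>{..k}. X l \<omega>) \<in> P k" using a by (auto simp: P_def)
      from bspec[OF b this] show "X (Suc k) \<omega> \<in> set_pmf (K (X k \<omega>))" by simp
    qed
  qed
  show A: "AE \<omega> in M. \<forall>l\<le>k. X l \<omega> \<in> set_pmf (chain_law K x0 l)" for k
  proof (induction k)
    case 0
    show ?case using AE_start by eventually_elim simp
  next
    case (Suc k)
    from Suc step[OF Suc] show ?case by eventually_elim (auto simp: le_Suc_eq)
  qed
  show "AE \<omega> in M. X (Suc k) \<omega> \<in> set_pmf (K (X k \<omega>))" by (rule step[OF A])
qed

lemma prob_state: "prob {\<omega> \<in> space M. X k \<omega> = z} = pmf (chain_law K x0 k) z"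
proof (induction k arbitrary: z)
  case 0
  have "prob {\<omega> \<in> space M. X 0 \<omega> = z} = (if x0 = z then 1 else 0)"
  proof (cases "x0 = z")
    case True
    then show ?thesis using AE_start by (simp add: prob_Collect_eq_1)
  next
    case False
    have "AE \<omega> in M. X 0 \<omega> \<noteq> z" using AE_start by eventually_elim (use False in auto)
    with False show ?thesis by (simp add: prob_Collect_eq_0)
  qed
  then show ?case by (simp add: indicator_def)
next
  case (Suc k)
  define P where "P = PiE {..k} (\<lambda>l. set_pmf (chain_law K x0 l))"
  \<comment> \<open>The Markov property conditions on the whole past. The event
    \<open>X k = a\<close> is split into the finitely many paths ending in \<open>a\<close>, all of
    which share the factor \<open>pmf (K a) z\<close>.\<close>
  have joint: "prob {\<omega> \<in> space M. X k \<omega> = a \<and> X (Suc k) \<omega> = z} = pmf (chain_law K x0 k) a * pmf (K a) z" for a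
  proof -
    define I where "I = {y \<in> P. y k = a}"
    have I: "finite I" unfolding I_def P_def
      by (intro finite_subset[OF _ finite_PiE[of "{..k}" "\<lambda>l. set_pmf (chain_law K x0 l)"]] finite_chain_law) auto
    have Ia: "y k = a" if "y \<in> I" for y using that by (simp add: I_def)
    have ex: "\<exists>!y\<in>I. past k y \<omega>" if "\<forall>l\<le>k. X l \<omega> \<in> set_pmf (chain_law K x0 l)" "X k \<omega> = a" for \<omega>
    proof (rule ex1I[of _ "\<lambda>l\<in>{..k}. X l \<omega>"])
      fix y assume "y \<in> I \<and> past k y \<omega>"
      then show "y = (\<lambda>l\<in>{..k}. X l \<omega>)"
        by (intro extensionalityI[of _ "{..k}"]) (auto simp: I_def P_def PiE_iff)
    qed (use that in \<open>auto simp: I_def P_def\<close>)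
    have "prob {\<omega> \<in> space M. X k \<omega> = a \<and> X (Suc k) \<omega> = z}
        = (\<Sum>y\<in>I. prob {\<omega> \<in> space M. past k y \<omega> \<and> X (Suc k) \<omega> = z})"
    proof (rule prob_sum)
      show "AE \<omega> in M. (\<forall>y\<in>I. past k y \<omega> \<and> X (Suc k) \<omega> = z \<longrightarrow> X k \<omega> = a \<and> X (Suc k) \<omega> = z) \<and>
        (X k \<omega> = a \<and> X (Suc k) \<omega> = z \<longrightarrow> (\<exists>!y\<in>I. past k y \<omega> \<and> X (Suc k) \<omega> = z))"
        using AE_support(1)[of k]
      proof eventually_elim
        case (elim \<omega>)
        show ?case
        proof (intro conjI ballI impI)
          fix y assume "y \<in> I" "past k y \<omega> \<and> X (Suc k) \<omega> = z"
          then show "X k \<omega> = a" using Ia by auto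
        next
          assume "X k \<omega> = a \<and> X (Suc k) \<omega> = z"
          with ex[OF elim] show "\<exists>!y\<in>I. past k y \<omega> \<and> X (Suc k) \<omega> = z" by auto
        qed auto
      qed
    qed (use I in auto)
    also have "\<dots> = (\<Sum>y\<in>I. prob {\<omega> \<in> space M. past k y \<omega>}) * pmf (K a) z"
      unfolding prob_step sum_distrib_right by (intro sum.cong) (auto simp: I_def)
    also have "(\<Sum>y\<in>I. prob {\<omega> \<in> space M. past k y \<omega>}) = prob {\<omega> \<in> space M. X k \<omega> = a}"
    proof (rule prob_sum[symmetric])
      show "AE \<omega> in M. (\<forall>y\<in>I. past k y \<omega> \<longrightarrow> X k \<omega> = a) \<and> (X k \<omega> = a \<longrightarrow> (\<exists>!y\<in>I. past k y \<omega>))"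
        using AE_support(1)[of k]
      proof eventually_elim
        case (elim \<omega>)
        show ?case
        proof (intro conjI ballI impI)
          fix y assume "y \<in> I" "past k y \<omega>"
          then show "X k \<omega> = a" using Ia by auto
        next
          assume "X k \<omega> = a"
          with ex[OF elim] show "\<exists>!y\<in>I. past k y \<omega>" by auto
        qed
      qed
    qed (use I in auto)
    finally show ?thesis by (simp add: Suc.IH)
  qed
  have "prob {\<omega> \<in> space M. X (Suc k) \<omega> = z}
      = (\<Sum>a\<in>set_pmf (chain_law K x0 k). prob {\<omega> \<in> space M. X k \<omega> = a \<and> X (Suc k) \<omega> = z})"
  proof (rule prob_sum)
    show "AE \<omega> in M. (\<forall>a\<in>set_pmf (chain_law K x0 k). X k \<omega> = a \<and> X (Suc k) \<omega> = z \<longrightarrow> X (Suc k) \<omega> = z) \<and>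
      (X (Suc k) \<omega> = z \<longrightarrow> (\<exists>!a\<in>set_pmf (chain_law K x0 k). X k \<omega> = a \<and> X (Suc k) \<omega> = z))"
      using AE_support(1)[of k] by eventually_elim auto
  qed (use finite_chain_law in auto)
  also have "\<dots> = pmf (chain_law K x0 (Suc k)) z"
    unfolding joint
    by (simp add: pmf_bind integral_measure_pmf_real[OF finite_chain_law] mult.commute)
  finally show ?case .
qed

text \<open>Deviation events are Borel sets rather than singletons; up to a null set they are finite
  disjoint unions of state events.\<close>

lemma prob_state_in:
  assumes B: "B \<in> sets borel"
  shows "prob {\<omega> \<in> space M. X k \<omega> \<in> B} = measure_pmf.prob (chain_law K x0 k) B"
proof -
  let ?S = "set_pmf (chain_law K x0 k)"
  have "prob {\<omega> \<in> space M. X k \<omega> \<in> B} = (\<Sum>a\<in>B \<inter> ?S. prob {\<omega> \<in> space M. X k \<omega> = a})"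
  proof (rule prob_sum)
    show "AE \<omega> in M. (\<forall>a\<in>B \<inter> ?S. X k \<omega> = a \<longrightarrow> X k \<omega> \<in> B) \<and> (X k \<omega> \<in> B \<longrightarrow> (\<exists>!a\<in>B \<inter> ?S. X k \<omega> = a))"
      using AE_support(1)[of k] by eventually_elim auto
    show "{\<omega> \<in> space M. X k \<omega> \<in> B} \<in> events" using B by measurable
  qed (use finite_chain_law in auto)
  also have "\<dots> = measure_pmf.prob (chain_law K x0 k) (B \<inter> ?S)"
    unfolding prob_state using finite_chain_law by (subst measure_measure_pmf_finite) auto
  also have "\<dots> = measure_pmf.prob (chain_law K x0 k) B" by (rule measure_Int_set_pmf)
  finally show ?thesis .
qed

end

section \<open>Fluid limits\<close>

lemma norm_increment_le:
  fixes f :: "real \<Rightarrow> 'b::real_normed_vector"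
  assumes "\<And>t. t \<in> {r..s} \<Longrightarrow> (f has_vector_derivative f' t) (at t within {r..s})"
    and "\<And>t. t \<in> {r..s} \<Longrightarrow> norm (f' t) \<le> B" and "r \<le> s"
  shows "norm (f s - f r) \<le> B * (s - r)"
proof -
  have "onorm (\<lambda>u. u *\<^sub>R f' t) \<le> B" if "t \<in> {r..s}" for t
  proof (rule onorm_bound)
    show "0 \<le> B" using assms(2)[OF that] norm_ge_zero order_trans by blast
    show "norm (u *\<^sub>R f' t) \<le> B * norm u" for u
      using mult_left_mono[OF assms(2)[OF that], of "\<bar>u\<bar>"] by (simp add: mult.commute)
  qed
  then show ?thesis
    using differentiable_bound[of "{r..s}" f "\<lambda>t u. u *\<^sub>R f' t" B s r] assms
    by (auto simp: has_vector_derivative_def)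
qed

text \<open>One step of the error recursion: the chain moves from \<open>y\<close> to a random
  \<open>z\<close>, the solution from \<open>w\<close> to \<open>w + d\<close>. The cross term is
  linear in \<open>z\<close>, so only the mean increment enters it; the remaining square is at most
  \<open>(2 * a)\<^sup>2\<close>.\<close>

lemma pmf_second_moment_step:
  fixes K :: "'b::euclidean_space pmf"
  assumes fin: "finite (set_pmf K)"
    and step: "\<And>z. z \<in> set_pmf K \<Longrightarrow> norm (z - y) \<le> a" and d: "norm d \<le> a"
  shows "measure_pmf.expectation K (\<lambda>z. (norm (z - (w + d)))\<^sup>2)
    \<le> (norm (y - w))\<^sup>2 + 2 * ((y - w) \<bullet> (measure_pmf.expectation K (\<lambda>z. z - y) - d)) + 4 * a\<^sup>2"
proof -
  note int = integrable_measure_pmf_finite[OF fin]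
  have "measure_pmf.expectation K (\<lambda>z. (norm (z - (w + d)))\<^sup>2)
      \<le> measure_pmf.expectation K (\<lambda>z. (norm (y - w))\<^sup>2 + 2 * ((y - w) \<bullet> ((z - y) - d)) + 4 * a\<^sup>2)"
  proof (rule integral_mono_AE[OF int int], unfold AE_measure_pmf_iff, rule ballI)
    fix z assume z: "z \<in> set_pmf K"
    have "norm ((z - y) - d) \<le> 2 * a"
      using norm_triangle_ineq4[of "z - y" d] step[OF z] d by linarith
    then have "(norm ((z - y) - d))\<^sup>2 \<le> (2 * a)\<^sup>2" by (intro power_mono) auto
    moreover have "(norm (z - (w + d)))\<^sup>2
        = (norm (y - w))\<^sup>2 + 2 * ((y - w) \<bullet> ((z - y) - d)) + (norm ((z - y) - d))\<^sup>2"
      unfolding power2_norm_eq_inner by (simp add: inner_simps inner_commute algebra_simps)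
    ultimately show "(norm (z - (w + d)))\<^sup>2
        \<le> (norm (y - w))\<^sup>2 + 2 * ((y - w) \<bullet> ((z - y) - d)) + 4 * a\<^sup>2"
      by (simp add: power_mult_distrib)
  qed
  also have "\<dots> = (norm (y - w))\<^sup>2
      + 2 * ((y - w) \<bullet> (measure_pmf.expectation K (\<lambda>z. z - y) - d)) + 4 * a\<^sup>2"
  proof -
    have "measure_pmf.expectation K (\<lambda>z. (y - w) \<bullet> ((z - y) - d))
        = (y - w) \<bullet> measure_pmf.expectation K (\<lambda>z. (z - y) - d)"
      using int by (intro integral_inner_right)
    also have "measure_pmf.expectation K (\<lambda>z. (z - y) - d) = measure_pmf.expectation K (\<lambda>z. z - y) - d"
      using int by (subst Bochner_Integration.integral_diff) auto
    finally have e: "measure_pmf.expectation K (\<lambda>z. (y - w) \<bullet> ((z - y) - d))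
        = (y - w) \<bullet> (measure_pmf.expectation K (\<lambda>z. z - y) - d)" .
    have "measure_pmf.expectation K (\<lambda>z. (norm (y - w))\<^sup>2 + 2 * ((y - w) \<bullet> ((z - y) - d)) + 4 * a\<^sup>2)
      = measure_pmf.expectation K (\<lambda>z. (norm (y - w))\<^sup>2 + 2 * ((y - w) \<bullet> ((z - y) - d))) + 4 * a\<^sup>2"
      by (subst Bochner_Integration.integral_add[OF int int]) simp
    also have "\<dots> = (norm (y - w))\<^sup>2 + measure_pmf.expectation K (\<lambda>z. 2 * ((y - w) \<bullet> ((z - y) - d))) + 4 * a\<^sup>2"
      by (subst Bochner_Integration.integral_add[OF int int]) simp
    finally show ?thesis unfolding integral_mult_right_zero e .
  qed
  finally show ?thesis .
qed

lemma pmf_expectation_bind_mono: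
  fixes \<phi> \<psi> :: "'b \<Rightarrow> real"
  assumes fin: "finite (set_pmf p)" "\<And>y. finite (set_pmf (K y))"
    and le: "\<And>y. y \<in> set_pmf p \<Longrightarrow> measure_pmf.expectation (K y) \<phi> \<le> \<psi> y"
  shows "measure_pmf.expectation (bind_pmf p K) \<phi> \<le> measure_pmf.expectation p \<psi>"
proof -
  have "measure_pmf.expectation (bind_pmf p K) \<phi>
      = (\<Sum>y\<in>set_pmf p. pmf p y *\<^sub>R measure_pmf.expectation (K y) \<phi>)"
    using fin by (intro pmf_expectation_bind) auto
  also have "\<dots> \<le> (\<Sum>y\<in>set_pmf p. pmf p y *\<^sub>R \<psi> y)"
    using le by (intro sum_mono scaleR_left_mono) auto
  also have "\<dots> = measure_pmf.expectation p \<psi>"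
    using fin by (intro integral_measure_pmf[symmetric]) auto
  finally show ?thesis .
qed

text \<open>The set \<open>S\<close> confines chain and solution alike, so regularity of
  \<open>b\<close> is asked for on \<open>S\<close> only. \<open>A\<close> is a speed,
  \<open>L\<close> a Lipschitz constant and \<open>R\<close> a radius of \<open>S\<close>; none of
  them is tied to \<open>h\<close>, which allows one choice for all small \<open>h\<close>.\<close>

locale fluid_kernel =
  fixes S :: "'b::euclidean_space set" and b :: "'b \<Rightarrow> 'b" and K :: "'b \<Rightarrow> 'b pmf"
    and h A L R T :: real and x0 :: 'b and X :: "real \<Rightarrow> 'b"
  assumes h: "0 < h"
    and finite_kernel: "\<And>y. finite (set_pmf (K y))"
    and kernel_closed: "\<And>y z. y \<in> S \<Longrightarrow> z \<in> set_pmf (K y) \<Longrightarrow> z \<in> S"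
    and kernel_step: "\<And>y z. y \<in> S \<Longrightarrow> z \<in> set_pmf (K y) \<Longrightarrow> norm (z - y) \<le> A * h"
    and kernel_mean: "\<And>y. y \<in> S \<Longrightarrow> measure_pmf.expectation (K y) (\<lambda>z. z - y) = h *\<^sub>R b y"
    and lipschitz: "L-lipschitz_on S b"
    and norm_bound: "\<And>y. y \<in> S \<Longrightarrow> norm y \<le> R"
    and T: "0 \<le> T"
    and solution: "solves_ivp T b x0 X"
    and solution_in: "\<And>t. t \<in> {0..T} \<Longrightarrow> X t \<in> S"
begin

lemma x0_in: "x0 \<in> S"
  using solution solution_in[of 0] T by (simp add: solves_ivp_def)

lemma chain_law_in: "y \<in> set_pmf (chain_law K x0 k) \<Longrightarrow> y \<in> S"
  by (induction k arbitrary: y) (auto simp: x0_in intro: kernel_closed)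

text \<open>The drift is the mean increment per unit of time, so the speed limit \<open>A\<close> of
  the chain is inherited by the solution.\<close>

lemma drift_bound: assumes y: "y \<in> S" shows "norm (b y) \<le> A"
proof -
  have "h * norm (b y) = norm (measure_pmf.expectation (K y) (\<lambda>z. z - y))"
    using h by (simp add: kernel_mean[OF y])
  also have "\<dots> \<le> measure_pmf.expectation (K y) (\<lambda>z. norm (z - y))"
    by (rule integral_norm_bound)
  also have "\<dots> \<le> measure_pmf.expectation (K y) (\<lambda>z. A * h)"
    by (intro integral_mono_AE integrable_measure_pmf_finite finite_kernel)
       (auto simp: AE_measure_pmf_iff kernel_step[OF y])
  finally show ?thesis using h by (simp add: mult.commute)
qed

lemma A_nonneg: "0 \<le> A"
  using drift_bound[OF x0_in] norm_ge_zero order_trans by blast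

lemma solution_derivative:
  assumes "{r..s} \<subseteq> {0..T}" "t \<in> {r..s}"
  shows "(X has_vector_derivative b (X t)) (at t within {r..s})"
  using assms solution unfolding solves_ivp_def by (blast intro: has_vector_derivative_within_subset)

lemma solution_increment:
  assumes "0 \<le> r" "r \<le> s" "s \<le> T"
  shows "norm (X s - X r) \<le> A * (s - r)"
  using assms
  by (intro norm_increment_le[where f' = "\<lambda>t. b (X t)"] solution_derivative drift_bound solution_in) auto

text \<open>Subtracting the tangent line leaves the derivative \<open>b (X t) - b (X r)\<close>,
  which is at most \<open>L\<close> times the distance travelled. One factor \<open>s - r\<close>
  thus comes from the derivative and one from integrating it.\<close>

lemma solution_euler:
  assumes "0 \<le> r" "r \<le> s" "s \<le> T"
  shows "norm (X s - X r - (s - r) *\<^sub>R b (X r)) \<le> L * A * (s - r)\<^sup>2"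
proof -
  have "norm ((X s - s *\<^sub>R b (X r)) - (X r - r *\<^sub>R b (X r))) \<le> (L * A * (s - r)) * (s - r)"
  proof (rule norm_increment_le)
    fix t assume t: "t \<in> {r..s}"
    have "((\<lambda>t. t *\<^sub>R b (X r)) has_vector_derivative b (X r)) (at t within {r..s})"
      by (auto simp: has_vector_derivative_def intro!: derivative_eq_intros)
    then show "((\<lambda>t. X t - t *\<^sub>R b (X r)) has_vector_derivative b (X t) - b (X r)) (at t within {r..s})"
      using t assms by (intro has_vector_derivative_diff solution_derivative) auto
    have "norm (b (X t) - b (X r)) \<le> L * norm (X t - X r)"
      using t assms by (intro lipschitz_on_normD[OF lipschitz] solution_in) auto
    also have "\<dots> \<le> L * (A * (s - r))"
    proof (rule mult_left_mono)
      have "norm (X t - X r) \<le> A * (t - r)" using t assms by (intro solution_increment) auto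
      also have "\<dots> \<le> A * (s - r)" using t A_nonneg by (intro mult_left_mono) auto
      finally show "norm (X t - X r) \<le> A * (s - r)" .
    qed (rule lipschitz_on_nonneg[OF lipschitz])
    finally show "norm (b (X t) - b (X r)) \<le> L * A * (s - r)" by simp
  qed (use assms in auto)
  then show ?thesis by (simp add: algebra_simps power2_eq_square)
qed

text \<open>The coefficient of \<open>h\<^sup>2\<close> in one step. The first summand is twice the
  Euler error \<open>L * A * h\<^sup>2\<close> times the bound \<open>2 * R\<close> on the distance
  of two points of \<open>S\<close>; the second is the square of \<open>2 * A * h\<close>, which
  bounds the difference of the two increments.\<close>

definition noise :: real where "noise = 4 * R * L * A + 4 * A\<^sup>2"

lemma noise_nonneg: "0 \<le> noise"
  using A_nonneg lipschitz_on_nonneg[OF lipschitz] norm_bound[OF x0_in] norm_ge_zero[of x0]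
  by (auto simp: noise_def simp del: norm_ge_zero)

lemma kernel_mean_square:
  assumes y: "y \<in> S" and t: "0 \<le> t" "t + h \<le> T"
  shows "measure_pmf.expectation (K y) (\<lambda>z. (norm (z - X (t + h)))\<^sup>2)
    \<le> (1 + 2 * L * h) * (norm (y - X t))\<^sup>2 + noise * h\<^sup>2"
proof -
  define w where "w = X t"
  define d where "d = X (t + h) - w"
  \<comment> \<open>The Euler error of the solution: the mean increments of chain and solution
    differ by \<open>h *\<^sub>R (b y - b w) - r\<close>.\<close>
  define r where "r = d - h *\<^sub>R b w"
  have w: "w \<in> S" unfolding w_def using t h by (intro solution_in) auto
  have d: "norm d \<le> A * h" using solution_increment[of t "t + h"] t h by (simp add: d_def w_def)
  have r: "norm r \<le> L * A * h\<^sup>2" using solution_euler[of t "t + h"] t h by (simp add: d_def w_def r_def)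
  have yw: "norm (y - w) \<le> 2 * R"
    using norm_triangle_ineq4[of y w] norm_bound[OF y] norm_bound[OF w] by linarith
  have "measure_pmf.expectation (K y) (\<lambda>z. (norm (z - (w + d)))\<^sup>2)
    \<le> (norm (y - w))\<^sup>2 + 2 * ((y - w) \<bullet> (h *\<^sub>R b y - d)) + 4 * (A * h)\<^sup>2"
    using pmf_second_moment_step[OF finite_kernel kernel_step[OF y] d, of y w]
    unfolding kernel_mean[OF y] by simp
  also have "(y - w) \<bullet> (h *\<^sub>R b y - d) \<le> norm (y - w) * norm (h *\<^sub>R (b y - b w) - r)"
    unfolding r_def using norm_cauchy_schwarz[of "y - w" "h *\<^sub>R b y - d"] by (simp add: algebra_simps)
  also have "\<dots> \<le> norm (y - w) * (h * (L * norm (y - w)) + L * A * h\<^sup>2)"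
  proof (rule mult_left_mono)
    have "norm (h *\<^sub>R (b y - b w) - r) \<le> h * norm (b y - b w) + norm r"
      using norm_triangle_ineq4[of "h *\<^sub>R (b y - b w)" r] h by simp
    also have "\<dots> \<le> h * (L * norm (y - w)) + L * A * h\<^sup>2"
      using lipschitz_on_normD[OF lipschitz y w] h r by (intro add_mono mult_left_mono) auto
    finally show "norm (h *\<^sub>R (b y - b w) - r) \<le> h * (L * norm (y - w)) + L * A * h\<^sup>2" .
  qed simp
  also have "\<dots> = L * h * (norm (y - w))\<^sup>2 + norm (y - w) * (L * A * h\<^sup>2)"
    by (simp add: algebra_simps power2_eq_square)
  also have "norm (y - w) * (L * A * h\<^sup>2) \<le> 2 * R * (L * A * h\<^sup>2)"
    using yw A_nonneg lipschitz_on_nonneg[OF lipschitz] by (intro mult_right_mono) auto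
  finally show ?thesis
    by (simp add: noise_def d_def w_def algebra_simps power_mult_distrib)
qed

lemma chain_mean_square:
  assumes "real k * h \<le> T"
  shows "measure_pmf.expectation (chain_law K x0 k) (\<lambda>y. (norm (y - X (real k * h)))\<^sup>2)
    \<le> noise * T * exp (2 * L * T) * h"
proof -
  have L: "0 \<le> L" using lipschitz by (rule lipschitz_on_nonneg)
  have fin: "finite (set_pmf (chain_law K x0 k))" for k
    by (induction k) (auto simp: finite_kernel)
  \<comment> \<open>Discrete Gronwall. This form survives the induction since a step multiplies by
    \<open>1 + 2 * L * h \<le> exp (2 * L * h)\<close> and adds \<open>noise * h\<^sup>2\<close>.
    Afterwards \<open>real k * h \<le> T\<close> absorbs one of the two factors
    \<open>h\<close>.\<close>
  have "measure_pmf.expectation (chain_law K x0 k) (\<lambda>y. (norm (y - X (real k * h)))\<^sup>2)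
    \<le> noise * h\<^sup>2 * real k * exp (2 * L * h * real k)" if "real k * h \<le> T" for k
    using that
  proof (induction k)
    case 0
    then show ?case using solution by (simp add: solves_ivp_def)
  next
    case (Suc k)
    have kh: "real (Suc k) * h = real k * h + h" by (simp add: algebra_simps)
    have k: "real k * h + h \<le> T" using Suc.prems kh by simp
    let ?\<phi> = "\<lambda>y. (norm (y - X (real k * h)))\<^sup>2"
    have "measure_pmf.expectation (chain_law K x0 (Suc k)) (\<lambda>y. (norm (y - X (real (Suc k) * h)))\<^sup>2)
      \<le> measure_pmf.expectation (chain_law K x0 k) (\<lambda>y. (1 + 2 * L * h) * ?\<phi> y + noise * h\<^sup>2)"
      unfolding kh chain_law.simps using h k
      by (intro pmf_expectation_bind_mono fin finite_kernel kernel_mean_square chain_law_in) auto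
    also have "\<dots> = (1 + 2 * L * h) * measure_pmf.expectation (chain_law K x0 k) ?\<phi> + noise * h\<^sup>2"
      using integrable_measure_pmf_finite[OF fin] by (subst Bochner_Integration.integral_add) auto
    also have "\<dots> \<le> exp (2 * L * h) * (noise * h\<^sup>2 * real k * exp (2 * L * h * real k)) + noise * h\<^sup>2"
      using Suc.IH k h L noise_nonneg exp_ge_add_one_self[of "2 * L * h"]
      by (intro add_mono mult_mono) (auto intro!: Bochner_Integration.integral_nonneg)
    also have "\<dots> \<le> noise * h\<^sup>2 * real k * exp (2 * L * h * real (Suc k))
        + noise * h\<^sup>2 * exp (2 * L * h * real (Suc k))"
    proof (rule add_mono)
      show "exp (2 * L * h) * (noise * h\<^sup>2 * real k * exp (2 * L * h * real k))
          \<le> noise * h\<^sup>2 * real k * exp (2 * L * h * real (Suc k))"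
        by (simp add: algebra_simps flip: exp_add)
      have "noise * h\<^sup>2 * 1 \<le> noise * h\<^sup>2 * exp (2 * L * h * real (Suc k))"
        using noise_nonneg L h by (intro mult_left_mono) auto
      then show "noise * h\<^sup>2 \<le> noise * h\<^sup>2 * exp (2 * L * h * real (Suc k))" by simp
    qed
    finally show ?case by (simp add: algebra_simps)
  qed
  from this[OF assms] have "measure_pmf.expectation (chain_law K x0 k) (\<lambda>y. (norm (y - X (real k * h)))\<^sup>2)
      \<le> (noise * h) * ((real k * h) * exp (2 * L * (real k * h)))"
    by (simp add: power2_eq_square mult_ac)
  also have "\<dots> \<le> (noise * h) * (T * exp (2 * L * T))"
    using assms noise_nonneg h L T by (intro mult_left_mono mult_mono) (auto intro: mult_left_mono)
  finally show ?thesis by (simp add: mult_ac)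
qed

lemma chain_deviation_prob:
  assumes k: "real k * h \<le> T" and \<delta>: "0 < \<delta>"
  shows "measure_pmf.prob (chain_law K x0 k) {y. \<delta> \<le> norm (y - X (real k * h))}
    \<le> noise * T * exp (2 * L * T) * h / \<delta>\<^sup>2"
proof -
  have fin: "finite (set_pmf (chain_law K x0 k))"
    by (induction k) (auto simp: finite_kernel)
  let ?\<phi> = "\<lambda>y. (norm (y - X (real k * h)))\<^sup>2"
  have "measure_pmf.prob (chain_law K x0 k) {y \<in> space (chain_law K x0 k). \<delta>\<^sup>2 \<le> ?\<phi> y}
      \<le> measure_pmf.expectation (chain_law K x0 k) ?\<phi> / \<delta>\<^sup>2"
    using \<delta> by (intro integral_Markov_inequality_measure[where A = "{}"] integrable_measure_pmf_finite fin) auto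
  also have "\<dots> \<le> noise * T * exp (2 * L * T) * h / \<delta>\<^sup>2"
    using chain_mean_square[OF k] \<delta> by (intro divide_right_mono) auto
  also have "{y \<in> space (chain_law K x0 k). \<delta>\<^sup>2 \<le> ?\<phi> y} = {y. \<delta> \<le> norm (y - X (real k * h))}"
    using \<delta> by (auto simp: abs_le_square_iff[symmetric])
  finally show ?thesis .
qed

text \<open>The last grid point before \<open>t\<close>, rounded down to a time of the chain, lies
  at most \<open>2 * \<delta>\<close> before \<open>t\<close>. Chain and solution each move by at
  most \<open>A * (2 * \<delta>)\<close> meanwhile, and \<open>\<delta>\<close> is the error at the
  grid point: hence \<open>1 + 4 * A\<close>.\<close>

lemma trajectory_close:
  fixes x :: "nat \<Rightarrow> 'b"
  assumes step: "\<And>k. norm (x (Suc k) - x k) \<le> A * h"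
    and \<delta>: "0 < \<delta>" "h \<le> \<delta>"
    and grid: "\<And>q. q \<le> nat \<lfloor>T / \<delta>\<rfloor> \<Longrightarrow>
      norm (x (nat \<lfloor>real q * \<delta> / h\<rfloor>) - X (real (nat \<lfloor>real q * \<delta> / h\<rfloor>) * h)) \<le> \<delta>"
    and t: "t \<in> {0..T}"
  shows "dist (trajectory T h x t) (X t) \<le> (1 + 4 * A) * \<delta>"
proof -
  have steps: "norm (x (k + n) - x k) \<le> A * h * real n" for k n
  proof (induction n)
    case (Suc n)
    have "norm (x (k + Suc n) - x k) \<le> norm (x (Suc (k + n)) - x (k + n)) + norm (x (k + n) - x k)"
      using norm_triangle_ineq[of "x (Suc (k + n)) - x (k + n)" "x (k + n) - x k"] by simp
    also have "\<dots> \<le> A * h + A * h * real n" using step Suc by (intro add_mono)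
    finally show ?case by (simp add: algebra_simps)
  qed simp
  \<comment> \<open>\<open>q\<close> numbers the last grid point up to \<open>t\<close>;
    \<open>k\<close> and \<open>l\<close> are the step counts of the chain at \<open>t\<close> and
    at that grid point.\<close>
  define q where "q = nat \<lfloor>t / \<delta>\<rfloor>"
  define k where "k = nat \<lfloor>t / h\<rfloor>"
  define l where "l = nat \<lfloor>real q * \<delta> / h\<rfloor>"
  have q: "real q \<le> t / \<delta>" "t / \<delta> < real q + 1" using t \<delta> unfolding q_def by (auto simp: of_nat_nat)
  then have qd: "real q * \<delta> \<le> t" "t < real q * \<delta> + \<delta>" using \<delta> by (auto simp: field_simps)
  have k: "real k \<le> t / h" using t h unfolding k_def by (auto simp: of_nat_nat)
  have l: "real l \<le> real q * \<delta> / h" "real q * \<delta> / h < real l + 1"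
    using \<delta> h unfolding l_def by (auto simp: of_nat_nat)
  have lh: "real l * h \<le> t" "t \<le> real l * h + 2 * \<delta>"
    using l h qd \<delta> by (auto simp: field_simps)
  have "l \<le> k" unfolding k_def l_def using qd h by (intro nat_mono floor_mono divide_right_mono) auto
  then obtain n where n: "k = l + n" using le_Suc_ex by blast
  have "h * real n \<le> 2 * \<delta>" using k lh h n by (auto simp: field_simps)
  then have "A * (h * real n) \<le> A * (2 * \<delta>)" using A_nonneg by (rule mult_left_mono)
  then have 1: "norm (x k - x l) \<le> A * (2 * \<delta>)" using steps[of l n] n by (simp add: mult_ac)
  have "q \<le> nat \<lfloor>T / \<delta>\<rfloor>" unfolding q_def
    using t \<delta> by (intro nat_mono floor_mono divide_right_mono) auto
  then have 2: "norm (x l - X (real l * h)) \<le> \<delta>" unfolding l_def by (rule grid)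
  have "norm (X t - X (real l * h)) \<le> A * (t - real l * h)"
    using lh t h by (intro solution_increment) auto
  also have "\<dots> \<le> A * (2 * \<delta>)" using lh A_nonneg by (intro mult_left_mono) auto
  finally have 3: "norm (X t - X (real l * h)) \<le> A * (2 * \<delta>)" .
  have "norm (x k - X t) \<le> norm (x k - x l) + norm (x l - X (real l * h)) + norm (X t - X (real l * h))"
    using norm_triangle_ineq[of "x k - x l" "x l - X (real l * h)"]
      norm_triangle_ineq4[of "x k - X (real l * h)" "X t - X (real l * h)"] by simp
  also have "\<dots> \<le> (1 + 4 * A) * \<delta>" using 1 2 3 by (simp add: algebra_simps)
  finally show ?thesis using t by (simp add: dist_norm trajectory_def k_def)
qed

end

section \<open>From convergence in probability to convergence in distribution\<close>

text \<open>Near \<open>c\<close> the test function is almost constant; elsewhere it is bounded and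
  the probability is small. Measurability is phrased by open sets, which is all that continuous test
  functions require. The constant limit lives on a one-point space.\<close>

lemma (in Metric_space) converges_in_distribution_const:
  fixes N :: "'i \<Rightarrow> 'w measure" and Y :: "'i \<Rightarrow> 'w \<Rightarrow> 'a"
  assumes c: "c \<in> M"
    and prob: "\<forall>\<^sub>F i in F. prob_space (N i)"
    and range: "\<And>i \<omega>. Y i \<omega> \<in> M"
    and events: "\<forall>\<^sub>F i in F. \<forall>U. openin mtopology U \<longrightarrow> {\<omega> \<in> space (N i). Y i \<omega> \<in> U} \<in> sets (N i)"
    and close: "\<And>\<epsilon>. 0 < \<epsilon> \<Longrightarrow> ((\<lambda>i. measure (N i) {\<omega> \<in> space (N i). Y i \<omega> \<notin> mball c \<epsilon>}) \<longlongrightarrow> 0) F"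
  shows "converges_in_distribution mtopology N Y (measure_pmf (return_pmf ())) (\<lambda>_. c) F"
  unfolding converges_in_distribution_def
proof (intro allI impI, elim conjE)
  fix f :: "'a \<Rightarrow> real"
  assume cont: "continuous_map mtopology euclideanreal f" and bdd: "bounded (f ` topspace mtopology)"
  obtain B where B: "B > 0" "\<And>g. g \<in> M \<Longrightarrow> \<bar>f g\<bar> \<le> B"
    using bdd unfolding bounded_pos by auto
  have "((\<lambda>i. \<integral>\<omega>. f (Y i \<omega>) \<partial>N i) \<longlongrightarrow> f c) F"
  proof (rule tendstoI)
    fix e :: real assume e: "0 < e"
    have "openin mtopology {g \<in> topspace mtopology. f g \<in> ball (f c) (e / 2)}"
      by (rule openin_continuous_map_preimage[OF cont]) simp
    moreover have "c \<in> {g \<in> topspace mtopology. f g \<in> ball (f c) (e / 2)}" using c e by simp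
    ultimately obtain r where r: "r > 0" "mball c r \<subseteq> {g \<in> topspace mtopology. f g \<in> ball (f c) (e / 2)}"
      unfolding openin_mtopology by blast
    \<comment> \<open>Away from the ball the integrand is at most \<open>2 * B\<close>, so this
      probability costs less than \<open>e / 2\<close>, the other half being spent on
      continuity.\<close>
    have "\<forall>\<^sub>F i in F. measure (N i) {\<omega> \<in> space (N i). Y i \<omega> \<notin> mball c r} < e / (4 * B)"
      using close[OF r(1)] e B(1) by (intro order_tendstoD(2)) auto
    then show "\<forall>\<^sub>F i in F. dist (\<integral>\<omega>. f (Y i \<omega>) \<partial>N i) (f c) < e"
      using prob events
    proof eventually_elim
      fix i
      let ?D = "{\<omega> \<in> space (N i). Y i \<omega> \<notin> mball c r}"
      assume small: "measure (N i) ?D < e / (4 * B)" and ps: "prob_space (N i)"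
        and ev: "\<forall>U. openin mtopology U \<longrightarrow> {\<omega> \<in> space (N i). Y i \<omega> \<in> U} \<in> sets (N i)"
      interpret prob_space "N i" by (rule ps)
      have "{\<omega> \<in> space (N i). Y i \<omega> \<in> mball c r} \<in> events" using ev openin_mball by blast
      then have "space (N i) - {\<omega> \<in> space (N i). Y i \<omega> \<in> mball c r} \<in> events" by (rule sets.compl_sets)
      also have "space (N i) - {\<omega> \<in> space (N i). Y i \<omega> \<in> mball c r} = ?D" by blast
      finally have D: "?D \<in> events" .
      have meas: "(\<lambda>\<omega>. f (Y i \<omega>)) \<in> borel_measurable (N i)"
      proof (rule borel_measurableI)
        fix V :: "real set" assume "open V"
        then have "openin mtopology {g \<in> topspace mtopology. f g \<in> V}"
          by (intro openin_continuous_map_preimage[OF cont]) simp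
        then have "{\<omega> \<in> space (N i). Y i \<omega> \<in> {g \<in> topspace mtopology. f g \<in> V}} \<in> events" using ev by blast
        also have "{\<omega> \<in> space (N i). Y i \<omega> \<in> {g \<in> topspace mtopology. f g \<in> V}}
            = (\<lambda>\<omega>. f (Y i \<omega>)) -` V \<inter> space (N i)"
          using range by auto
        finally show "(\<lambda>\<omega>. f (Y i \<omega>)) -` V \<inter> space (N i) \<in> events" .
      qed
      have int: "integrable (N i) (\<lambda>\<omega>. f (Y i \<omega>))"
        using B range meas by (intro integrable_const_bound[of _ B]) auto
      have "\<bar>(\<integral>\<omega>. f (Y i \<omega>) \<partial>N i) - f c\<bar> = \<bar>\<integral>\<omega>. f (Y i \<omega>) - f c \<partial>N i\<bar>"
        using int by (simp add: prob_space)
      also have "\<dots> \<le> (\<integral>\<omega>. \<bar>f (Y i \<omega>) - f c\<bar> \<partial>N i)"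
        by (rule integral_abs_bound)
      also have "\<dots> \<le> (\<integral>\<omega>. e / 2 + 2 * B * indicator ?D \<omega> \<partial>N i)"
      proof (rule integral_mono)
        show "integrable (N i) (\<lambda>\<omega>. \<bar>f (Y i \<omega>) - f c\<bar>)" using int by simp
        show "integrable (N i) (\<lambda>\<omega>. e / 2 + 2 * B * indicator ?D \<omega>)"
          using D by (intro Bochner_Integration.integrable_add integrable_mult_right integrable_real_indicator)
            (auto simp: emeasure_eq_measure)
        fix \<omega> assume \<omega>: "\<omega> \<in> space (N i)"
        show "\<bar>f (Y i \<omega>) - f c\<bar> \<le> e / 2 + 2 * B * indicator ?D \<omega>"
        proof (cases "Y i \<omega> \<in> mball c r")
          case True
          then have "dist (f c) (f (Y i \<omega>)) < e / 2" using r(2) by (auto simp: mem_ball)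
          then show ?thesis using True by (simp add: dist_real_def abs_minus_commute)
        next
          case False
          have "\<bar>f (Y i \<omega>) - f c\<bar> \<le> 2 * B" using B(2)[OF range, of i \<omega>] B(2)[OF c] by linarith
          then show ?thesis using False \<omega> e by simp
        qed
      qed
      also have "\<dots> = e / 2 + 2 * B * measure (N i) ?D"
        using D by (subst Bochner_Integration.integral_add) (auto simp: emeasure_eq_measure prob_space)
      also have "\<dots> < e" using small B(1) by (simp add: field_simps)
      finally show "dist (\<integral>\<omega>. f (Y i \<omega>) \<partial>N i) (f c) < e" by (simp add: dist_real_def)
    qed
  qed
  then show "((\<lambda>i. \<integral>\<omega>. f (Y i \<omega>) \<partial>N i) \<longlongrightarrow> (\<integral>\<omega>. f c \<partial>measure_pmf (return_pmf ()))) F"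
    by simp
qed

lemma continuous_on_cadlag:
  assumes "continuous_on {0..T} f"
  shows "restrict f {0..T} \<in> cadlag_space T"
proof -
  have "continuous_on {0..T} (restrict f {0..T})"
    using assms by (rule continuous_on_eq) auto
  then have c: "(restrict f {0..T} \<longlongrightarrow> restrict f {0..T} t) (at t within {0..T})" if "t \<in> {0..T}" for t
    using that unfolding continuous_on_def by blast
  have "(restrict f {0..T} \<longlongrightarrow> restrict f {0..T} t) (at t within {t<..T})"
    "(restrict f {0..T} \<longlongrightarrow> restrict f {0..T} t) (at t within {0..<t})" if "t \<in> {0..T}" for t
    using that by (intro tendsto_within_subset[OF c]; auto)+
  then show ?thesis unfolding cadlag_space_def by blast
qed

context fluid_kernel
begin

text \<open>Off a null set every step obeys the speed limit, so a trajectory far from the solution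
  must already fail at one of the \<open>1 + nat \<lfloor>T / \<delta>\<rfloor>\<close> grid points.
  The union bound has a number of terms independent of \<open>h\<close>.\<close>

lemma trajectory_deviation_prob:
  assumes chain: "markov_chain M x K x0" and \<delta>: "0 < \<delta>" "h \<le> \<delta>"
  shows "measure M {\<omega> \<in> space M. trajectory T h (\<lambda>k. x k \<omega>) \<notin>
      Metric_space.mball (cadlag_space T) (skorokhod_dist T) (restrict X {0..T}) ((2 + 4 * A) * \<delta>)}
    \<le> (1 + real (nat \<lfloor>T / \<delta>\<rfloor>)) * (noise * T * exp (2 * L * T) * h / \<delta>\<^sup>2)"
proof -
  interpret chain: finite_markov_chain M x K x0
    using chain finite_kernel by unfold_locales
  interpret Sk: Metric_space "cadlag_space T :: (real \<Rightarrow> 'b) set" "skorokhod_dist T"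
    using T by (rule Metric_space_skorokhod)
  define Q where "Q = nat \<lfloor>T / \<delta>\<rfloor>"
  define k where "k q = nat \<lfloor>real q * \<delta> / h\<rfloor>" for q :: nat
  define D where "D q = {\<omega> \<in> space M. x (k q) \<omega> \<in> {y. \<delta> \<le> norm (y - X (real (k q) * h))}}" for q
  have kT: "real (k q) * h \<le> T" if "q \<le> Q" for q
  proof -
    have "real q \<le> real Q" using that by simp
    also have "real Q \<le> T / \<delta>" using T \<delta> by (simp add: Q_def of_nat_nat)
    finally have "real q * \<delta> \<le> T" using \<delta> by (simp add: field_simps)
    moreover have "real (k q) \<le> real q * \<delta> / h" using h \<delta> by (simp add: k_def of_nat_nat)
    ultimately show ?thesis using h by (simp add: field_simps)
  qed
  have closed: "closed {y :: 'b. \<delta> \<le> norm (y - X (real (k q) * h))}" for q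
    by (intro closed_Collect_le continuous_intros)
  then have D: "D q \<in> sets M" for q
    unfolding D_def using measurable_sets[OF chain.X_measurable borel_closed[OF closed], of "k q" q]
    by (simp add: vimage_def Int_def conj_commute)
  have Dp: "measure M (D q) \<le> noise * T * exp (2 * L * T) * h / \<delta>\<^sup>2" if "q \<le> Q" for q
    unfolding D_def using chain.prob_state_in[OF borel_closed[OF closed], of "k q" q]
      chain_deviation_prob[OF kT[OF that] \<delta>(1)] by simp
  have "AE \<omega> in M. \<forall>k. x (Suc k) \<omega> \<in> set_pmf (K (x k \<omega>))"
    unfolding AE_all_countable using chain.AE_support(2) by blast
  moreover have "AE \<omega> in M. x k \<omega> \<in> set_pmf (chain_law K x0 k)" for k
    using chain.AE_support(1)[of k] by eventually_elim simp
  then have "AE \<omega> in M. \<forall>k. x k \<omega> \<in> set_pmf (chain_law K x0 k)"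
    by (simp add: AE_all_countable)
  ultimately have "AE \<omega> in M. \<omega> \<in> {\<omega> \<in> space M. trajectory T h (\<lambda>k. x k \<omega>) \<notin>
      Sk.mball (restrict X {0..T}) ((2 + 4 * A) * \<delta>)} \<longrightarrow> \<omega> \<in> (\<Union>q\<in>{..Q}. D q)"
  proof eventually_elim
    case (elim \<omega>)
    have step: "norm (x (Suc k) \<omega> - x k \<omega>) \<le> A * h" for k
      using elim chain_law_in by (blast intro: kernel_step)
    show ?case
    proof (rule impI, rule ccontr)
      assume \<omega>: "\<omega> \<in> {\<omega> \<in> space M. trajectory T h (\<lambda>k. x k \<omega>) \<notin>
          Sk.mball (restrict X {0..T}) ((2 + 4 * A) * \<delta>)}"
        and "\<omega> \<notin> (\<Union>q\<in>{..Q}. D q)"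
      then have grid: "norm (x (k q) \<omega> - X (real (k q) * h)) \<le> \<delta>" if "q \<le> Q" for q
        using that unfolding D_def by force
      have tc: "trajectory T h (\<lambda>k. x k \<omega>) \<in> cadlag_space T" by (rule trajectory_cadlag[OF h])
      have Xc: "restrict X {0..T} \<in> cadlag_space T"
        by (intro continuous_on_cadlag solves_ivp_continuous_on[OF solution])
      have "skorokhod_bound T (restrict X {0..T}) (trajectory T h (\<lambda>k. x k \<omega>)) (\<lambda>t. t) ((1 + 4 * A) * \<delta>)"
        unfolding skorokhod_bound_def
      proof (intro conjI ballI time_change_id)
        fix t assume t: "t \<in> {0..T}"
        show "\<bar>t - t\<bar> \<le> (1 + 4 * A) * \<delta>" using A_nonneg \<delta> by simp
        have "dist (trajectory T h (\<lambda>k. x k \<omega>) t) (X t) \<le> (1 + 4 * A) * \<delta>"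
          using step \<delta> grid t by (intro trajectory_close) (auto simp: Q_def k_def)
        then show "dist (restrict X {0..T} t) (trajectory T h (\<lambda>k. x k \<omega>) t) \<le> (1 + 4 * A) * \<delta>"
          using t by (simp add: dist_commute)
      qed
      \<comment> \<open>Balls are open, so one more \<open>\<delta>\<close> makes the inequality
        strict; this is why the radius has \<open>2 + 4 * A\<close> in place of
        \<open>1 + 4 * A\<close>.\<close>
      from skorokhod_dist_le[OF T Xc tc this]
      have "skorokhod_dist T (restrict X {0..T}) (trajectory T h (\<lambda>k. x k \<omega>)) < (2 + 4 * A) * \<delta>"
        using \<delta> by (simp add: algebra_simps)
      then show False using \<omega> tc Xc by simp
    qed
  qed
  then have "measure M {\<omega> \<in> space M. trajectory T h (\<lambda>k. x k \<omega>) \<notin>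
      Sk.mball (restrict X {0..T}) ((2 + 4 * A) * \<delta>)} \<le> measure M (\<Union>q\<in>{..Q}. D q)"
    using D by (intro chain.finite_measure_mono_AE) auto
  also have "\<dots> \<le> (\<Sum>q\<in>{..Q}. measure M (D q))"
    using D by (intro chain.finite_measure_subadditive_finite) auto
  also have "\<dots> \<le> (\<Sum>q\<in>{..Q}. noise * T * exp (2 * L * T) * h / \<delta>\<^sup>2)"
    using Dp by (intro sum_mono) auto
  finally show ?thesis by (simp add: Q_def)
qed

end

theorem fluid_limit:
  fixes S :: "'b::euclidean_space set"
  assumes kernel: "\<forall>\<^sub>F h in at_right 0. fluid_kernel S b (K h) h A L R T x0 X"
    and chain: "\<And>h. 0 < h \<Longrightarrow> markov_chain (M h) (x h) (K h) x0"
  shows "converges_in_distribution (skorokhod_topology T)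
    M (\<lambda>h \<omega>. trajectory T h (\<lambda>k. x h k \<omega>))
    (measure_pmf (return_pmf ())) (\<lambda>_. restrict X {0..T}) (at_right 0)"
proof -
  have pos: "\<forall>\<^sub>F h :: real in at_right 0. 0 < h" by (rule eventually_at_right_less)
  \<comment> \<open>Any admissible \<open>h0\<close> gives access to the facts about the solution
    and the constants; \<open>noise\<close> depends on \<open>A\<close>, \<open>L\<close> and
    \<open>R\<close> only and is the same for every \<open>h\<close>.\<close>
  obtain h0 where "fluid_kernel S b (K h0) h0 A L R T x0 X"
    using eventually_happens[OF kernel] by auto
  then interpret fluid_kernel S b "K h0" h0 A L R T x0 X .
  interpret Sk: Metric_space "cadlag_space T :: (real \<Rightarrow> 'b) set" "skorokhod_dist T"
    using T by (rule Metric_space_skorokhod)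
  \<comment> \<open>For \<open>h \<le> 0\<close> a trajectory need not be cadlag.\<close>
  define Y where "Y h \<omega> = (if 0 < h then trajectory T h (\<lambda>k. x h k \<omega>) else restrict X {0..T})" for h \<omega>
  have Xc: "restrict X {0..T} \<in> cadlag_space T"
    by (intro continuous_on_cadlag solves_ivp_continuous_on[OF solution])
  have "converges_in_distribution Sk.mtopology M Y
      (measure_pmf (return_pmf ())) (\<lambda>_. restrict X {0..T}) (at_right 0)"
  proof (rule Sk.converges_in_distribution_const)
    show "\<forall>\<^sub>F h in at_right 0. prob_space (M h)"
      using pos by eventually_elim (use chain in \<open>auto simp: markov_chain_def\<close>)
    show "Y h \<omega> \<in> cadlag_space T" for h \<omega> using Xc trajectory_cadlag by (auto simp: Y_def)
    show "\<forall>\<^sub>F h in at_right 0. \<forall>U. openin Sk.mtopology U \<longrightarrow> {\<omega> \<in> space (M h). Y h \<omega> \<in> U} \<in> sets (M h)"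
      using pos
    proof eventually_elim
      case (elim h)
      then show ?case
        using trajectory_random_element[OF T elim, of "x h" "M h"] chain[OF elim]
        by (simp add: Y_def markov_chain_def skorokhod_topology_def)
    qed
    fix \<epsilon> :: real assume \<epsilon>: "0 < \<epsilon>"
    define \<delta> where "\<delta> = \<epsilon> / (2 + 4 * A)"
    have A: "0 < 2 + 4 * A" using A_nonneg by simp
    have \<delta>: "0 < \<delta>" "(2 + 4 * A) * \<delta> = \<epsilon>" using \<epsilon> A by (auto simp: \<delta>_def)
    show "((\<lambda>h. measure (M h) {\<omega> \<in> space (M h). Y h \<omega> \<notin> Sk.mball (restrict X {0..T}) \<epsilon>}) \<longlongrightarrow> 0) (at_right 0)"
    proof (rule tendsto_sandwich[OF _ _ tendsto_const])
      show "\<forall>\<^sub>F h in at_right 0. 0 \<le> measure (M h) {\<omega> \<in> space (M h). Y h \<omega> \<notin> Sk.mball (restrict X {0..T}) \<epsilon>}"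
        by simp
      \<comment> \<open>The grid width \<open>\<delta>\<close> is fixed by \<open>\<epsilon>\<close>
        before \<open>h\<close> tends to 0, so the bound below is a constant multiple of
        \<open>h\<close>.\<close>
      have "\<forall>\<^sub>F h in at_right 0. h < \<delta>" using \<delta> eventually_at_right[OF \<delta>(1)] by blast
      then show "\<forall>\<^sub>F h in at_right 0. measure (M h) {\<omega> \<in> space (M h). Y h \<omega> \<notin> Sk.mball (restrict X {0..T}) \<epsilon>}
          \<le> (1 + real (nat \<lfloor>T / \<delta>\<rfloor>)) * (noise * T * exp (2 * L * T) * h / \<delta>\<^sup>2)"
        using kernel pos
      proof eventually_elim
        case (elim h)
        then show ?case
          using fluid_kernel.trajectory_deviation_prob[OF elim(2) chain[OF elim(3)] \<delta>(1)] \<delta>(2)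
          by (simp add: Y_def)
      qed
      show "((\<lambda>h. (1 + real (nat \<lfloor>T / \<delta>\<rfloor>)) * (noise * T * exp (2 * L * T) * h / \<delta>\<^sup>2)) \<longlongrightarrow> 0) (at_right 0)"
        using \<delta> by (auto intro!: tendsto_eq_intros)
    qed
  qed (rule Xc)
  then show ?thesis
    unfolding converges_in_distribution_def skorokhod_topology_def
  proof (intro allI impI, elim allE impE)
    fix f :: "(real \<Rightarrow> 'b) \<Rightarrow> real"
    assume "((\<lambda>h. \<integral>\<omega>. f (Y h \<omega>) \<partial>M h) \<longlongrightarrow> (\<integral>\<omega>. f (restrict X {0..T}) \<partial>measure_pmf (return_pmf ()))) (at_right 0)"
    then show "((\<lambda>h. \<integral>\<omega>. f (trajectory T h (\<lambda>k. x h k \<omega>)) \<partial>M h)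
        \<longlongrightarrow> (\<integral>\<omega>. f (restrict X {0..T}) \<partial>measure_pmf (return_pmf ()))) (at_right 0)"
      by (rule Lim_transform_eventually) (use pos in eventually_elim, simp add: Y_def)
  qed
qed

section \<open>The interaction kernel and its drift\<close>

text \<open>A ball of the maximum norm: averaging coordinates preserves it, whereas it can increase
  the Euclidean norm.\<close>

abbreviation opinion_box :: "real \<Rightarrow> (real^'n) set" where
  "opinion_box R \<equiv> cbox (vec (- R)) (vec R)"

lemma mem_opinion_box: "x \<in> opinion_box R \<longleftrightarrow> (\<forall>i. \<bar>x $ i\<bar> \<le> R)"
  unfolding mem_box_cart vec_component abs_le_iff by (rule all_cong1) linarith

definition mean_opinion :: "('n::finite \<Rightarrow> 'n \<Rightarrow> real^'n \<Rightarrow> real) \<Rightarrow> real^'n \<Rightarrow> real^'n" where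
  "mean_opinion p x = (\<chi> i. \<Sum>j\<in>UNIV. select_prob p i x j * x $ j)"

lemma interact_minus: "interact \<mu> i j y - y = axis i (\<mu> * (y $ j - y $ i))"
  by (auto simp: interact_def axis_def vec_eq_iff)

text \<open>For \<open>\<mu>\<close> in \<open>[0,1]\<close> the new opinion is a convex combination
  of two old ones. With update distance \<open>N h\<close> this is the source of the restriction to
  small \<open>h\<close>.\<close>

lemma interact_in:
  assumes y: "y \<in> opinion_box R" and \<mu>: "0 \<le> \<mu>" "\<mu> \<le> 1"
  shows "interact \<mu> i j y \<in> opinion_box R"
proof -
  have "\<bar>y $ i + \<mu> * (y $ j - y $ i)\<bar> \<le> R"
  proof -
    have "y $ i + \<mu> * (y $ j - y $ i) = (1 - \<mu>) * y $ i + \<mu> * y $ j" by (simp add: algebra_simps)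
    also have "\<bar>\<dots>\<bar> \<le> (1 - \<mu>) * \<bar>y $ i\<bar> + \<mu> * \<bar>y $ j\<bar>"
      using \<mu> by (intro order_trans[OF abs_triangle_ineq]) (simp add: abs_mult)
    also have "\<dots> \<le> (1 - \<mu>) * R + \<mu> * R"
      using y \<mu> by (intro add_mono mult_left_mono) (auto simp: mem_opinion_box)
    finally show ?thesis by (simp add: algebra_simps)
  qed
  then show ?thesis using y by (simp add: mem_opinion_box interact_def)
qed

lemma norm_interact_minus_le:
  fixes y :: "real^'n::finite"
  assumes "y \<in> opinion_box R" "0 \<le> \<mu>"
  shows "norm (interact \<mu> i j y - y) \<le> \<mu> * (2 * R)"
proof -
  have "\<bar>y $ j - y $ i\<bar> \<le> 2 * R"
    using assms(1)[unfolded mem_opinion_box, rule_format, of i]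
      assms(1)[unfolded mem_opinion_box, rule_format, of j] by linarith
  moreover have "interact \<mu> i j y - y = (\<mu> * (y $ j - y $ i)) *\<^sub>R axis i 1"
    unfolding interact_minus by (simp add: vec_eq_iff axis_def)
  ultimately show ?thesis
    using assms(2) by (simp add: abs_mult mult_left_mono)
qed

section \<open>Selection probabilities and regularity of the drift\<close>

locale interaction_rates =
  fixes p :: "'n::finite \<Rightarrow> 'n \<Rightarrow> real^'n \<Rightarrow> real" and c :: real
  assumes p_range: "\<And>i j y. p i j y \<in> {0..1}"
    and p_lipschitz: "\<And>i j. \<exists>L. L-lipschitz_on UNIV (p i j)"
    and c: "0 < c"
    and p_diag: "\<And>i y. c < p i i y"
begin

lemma p_nonneg: "0 \<le> p i j y"
  using p_range[of i j y] by auto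

lemma total_gt: "c < (\<Sum>l\<in>UNIV. p i l y)"
proof -
  have "p i i y \<le> (\<Sum>l\<in>UNIV. p i l y)"
    by (rule member_le_sum) (auto simp: p_nonneg)
  then show ?thesis using p_diag[where i = i and y = y] by linarith
qed

lemma total_pos: "0 < (\<Sum>l\<in>UNIV. p i l y)"
  using total_gt[where i = i and y = y] c by linarith

lemma select_prob_nonneg: "0 \<le> select_prob p i y j"
  unfolding select_prob_def using p_nonneg total_pos by (intro divide_nonneg_pos)

lemma sum_select_prob: "(\<Sum>j\<in>UNIV. select_prob p i y j) = 1"
  using total_pos[where i = i and y = y] by (simp add: select_prob_def flip: sum_divide_distrib)

lemma select_prob_le_1: "select_prob p i y j \<le> 1"
  using member_le_sum[of j UNIV "select_prob p i y"] by (simp add: select_prob_nonneg sum_select_prob)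

lemma pmf_select: "pmf (embed_pmf (select_prob p i y)) j = select_prob p i y j"
  by (intro pmf_select_prob p_nonneg total_pos)

lemma abs_weighted_mean_le:
  assumes "\<And>j. \<bar>v j\<bar> \<le> R"
  shows "\<bar>\<Sum>j\<in>UNIV. select_prob p i y j * v j\<bar> \<le> R"
proof -
  have "\<bar>\<Sum>j\<in>UNIV. select_prob p i y j * v j\<bar> \<le> (\<Sum>j\<in>UNIV. select_prob p i y j * R)"
    using assms by (intro order_trans[OF sum_abs] sum_mono)
      (auto simp: abs_mult select_prob_nonneg intro: mult_left_mono)
  then show ?thesis by (simp add: sum_select_prob flip: sum_distrib_right)
qed

lemma mean_opinion_in: "x \<in> opinion_box R \<Longrightarrow> mean_opinion p x \<in> opinion_box R"
  by (simp add: mem_opinion_box mean_opinion_def abs_weighted_mean_le)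

lemma drift_eq: "drift p x = mean_opinion p x - x"
proof (rule vec_eq_iff[THEN iffD2], rule allI)
  fix i
  have "drift p x $ i = (\<Sum>j\<in>UNIV. select_prob p i x j * (x $ j - x $ i))"
    by (simp add: drift_def select_prob_def sum_distrib_left divide_inverse mult_ac)
  also have "\<dots> = (\<Sum>j\<in>UNIV. select_prob p i x j * x $ j) - (\<Sum>j\<in>UNIV. select_prob p i x j) * x $ i"
    by (simp add: right_diff_distrib sum_subtractf sum_distrib_right)
  finally show "drift p x $ i = (mean_opinion p x - x) $ i"
    by (simp add: mean_opinion_def sum_select_prob)
qed

text \<open>The diagonal bound keeps the normalising sum above \<open>c\<close>, so the quotient of
  Lipschitz functions stays Lipschitz. The numerator contributes \<open>l / c\<close> and the
  \<open>N\<close> summands of the normaliser contribute \<open>N * l / c\<close>.\<close>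

lemma select_prob_lipschitz: "\<exists>L\<ge>0. \<forall>i j x y. \<bar>select_prob p i x j - select_prob p i y j\<bar> \<le> L * norm (x - y)"
proof -
  obtain L where L: "\<And>i j. (L i j)-lipschitz_on UNIV (p i j)" using p_lipschitz by metis
  define l where "l = (\<Sum>i\<in>UNIV. \<Sum>j\<in>UNIV. L i j)"
  have L0: "0 \<le> L i j" for i j using L by (rule lipschitz_on_nonneg)
  have l: "L i j \<le> l" for i j
    using member_le_sum[of j UNIV "L i"] member_le_sum[of i UNIV "\<lambda>i. \<Sum>j\<in>UNIV. L i j"] L0
    by (force simp: l_def intro: sum_nonneg)
  have pl: "\<bar>p i j x - p i j y\<bar> \<le> l * norm (x - y)" for i j x y
    using lipschitz_on_normD[OF L, of x y i j] mult_right_mono[OF l[of i j] norm_ge_zero[of "x - y"]] by simp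
  have "\<bar>select_prob p i x j - select_prob p i y j\<bar> \<le> (1 + real CARD('n)) * l / c * norm (x - y)" for i j x y
  proof -
    define s where "s = (\<Sum>k\<in>UNIV. p i k x)"
    define s' where "s' = (\<Sum>k\<in>UNIV. p i k y)"
    have s: "c < s" "0 < s" "0 < s'" using total_gt total_pos by (auto simp: s_def s'_def)
    have q: "0 \<le> p i j y / s'" "p i j y / s' \<le> 1"
      using select_prob_nonneg[of i y j] select_prob_le_1[of i y j] by (auto simp: select_prob_def s'_def)
    have "\<bar>s' - s\<bar> \<le> (\<Sum>k\<in>(UNIV::'n set). \<bar>p i k y - p i k x\<bar>)"
      unfolding s_def s'_def by (simp flip: sum_subtractf add: sum_abs)
    also have "\<dots> \<le> (\<Sum>k\<in>(UNIV::'n set). l * norm (x - y))"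
      by (intro sum_mono) (metis pl abs_minus_commute)
    finally have ss: "\<bar>s' - s\<bar> \<le> real CARD('n) * (l * norm (x - y))" by simp
    \<comment> \<open>In this form the second normaliser occurs only inside
      \<open>p i j y / s'\<close>, a probability and hence at most 1; a single division by
      \<open>s > c\<close> remains.\<close>
    have "select_prob p i x j - select_prob p i y j = ((p i j x - p i j y) + p i j y / s' * (s' - s)) / s"
      using s by (simp add: select_prob_def s_def[symmetric] s'_def[symmetric] field_simps)
    then have "\<bar>select_prob p i x j - select_prob p i y j\<bar>
        = \<bar>(p i j x - p i j y) + p i j y / s' * (s' - s)\<bar> / s"
      using s by simp
    also have "\<dots> \<le> (l * norm (x - y) + real CARD('n) * (l * norm (x - y))) / c"
    proof (rule frac_le)
      have "\<bar>p i j y / s' * (s' - s)\<bar> \<le> 1 * \<bar>s' - s\<bar>"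
        unfolding abs_mult using q by (intro mult_right_mono) auto
      then have "\<bar>p i j y / s' * (s' - s)\<bar> \<le> real CARD('n) * (l * norm (x - y))" using ss by simp
      then show "\<bar>(p i j x - p i j y) + p i j y / s' * (s' - s)\<bar>
          \<le> l * norm (x - y) + real CARD('n) * (l * norm (x - y))"
        by (intro order_trans[OF abs_triangle_ineq] add_mono pl)
      have "0 \<le> l" using L0 by (auto simp: l_def intro!: sum_nonneg)
      then show "0 \<le> l * norm (x - y) + real CARD('n) * (l * norm (x - y))" by simp
    qed (use s c in auto)
    finally show ?thesis by (simp add: algebra_simps add_divide_distrib)
  qed
  moreover have "0 \<le> (1 + real CARD('n)) * l / c"
    using L0 c by (auto simp: l_def intro!: sum_nonneg divide_nonneg_pos mult_nonneg_nonneg)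
  ultimately show ?thesis by blast
qed

text \<open>Product rule: the variation of the weights is multiplied by opinions of size at most
  \<open>R\<close>, while the variation of the opinions is averaged with weights summing to
  one.\<close>

lemma mean_opinion_lipschitz: "\<exists>L. L-lipschitz_on (opinion_box R) (mean_opinion p)"
proof -
  obtain L where L: "0 \<le> L" "\<And>i j x y. \<bar>select_prob p i x j - select_prob p i y j\<bar> \<le> L * norm (x - y)"
    using select_prob_lipschitz by blast
  define N where "N = real CARD('n)"
  \<comment> \<open>The outer \<open>N\<close> comes from summing over coordinates, the inner one
    from the sum over \<open>j\<close>. Writing \<open>\<bar>R\<bar>\<close> keeps the constant
    nonnegative for negative \<open>R\<close>, when the box is empty.\<close>
  have "norm (mean_opinion p x - mean_opinion p y) \<le> N * (N * L * \<bar>R\<bar> + 1) * norm (x - y)"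
    if x: "x \<in> opinion_box R" for x y
  proof -
    have "\<bar>(mean_opinion p x - mean_opinion p y) $ i\<bar> \<le> (N * L * \<bar>R\<bar> + 1) * norm (x - y)" for i
    proof -
      have "(mean_opinion p x - mean_opinion p y) $ i
          = (\<Sum>j\<in>UNIV. (select_prob p i x j - select_prob p i y j) * x $ j)
            + (\<Sum>j\<in>UNIV. select_prob p i y j * (x $ j - y $ j))"
        by (simp add: mean_opinion_def algebra_simps sum_subtractf flip: sum.distrib)
      also have "\<bar>\<dots>\<bar> \<le> (\<Sum>j\<in>(UNIV::'n set). (L * norm (x - y)) * \<bar>R\<bar>) + norm (x - y)"
      proof (rule order_trans[OF abs_triangle_ineq add_mono])
        show "\<bar>\<Sum>j\<in>UNIV. (select_prob p i x j - select_prob p i y j) * x $ j\<bar>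
            \<le> (\<Sum>j\<in>(UNIV::'n set). (L * norm (x - y)) * \<bar>R\<bar>)"
          using x L unfolding mem_opinion_box
          by (intro order_trans[OF sum_abs] sum_mono)
             (auto simp: abs_mult intro!: mult_mono intro: order_trans[OF _ abs_ge_self])
        show "\<bar>\<Sum>j\<in>UNIV. select_prob p i y j * (x $ j - y $ j)\<bar> \<le> norm (x - y)"
          using component_le_norm_cart[of "x - y"] by (intro abs_weighted_mean_le) simp
      qed
      finally show ?thesis by (simp add: N_def algebra_simps)
    qed
    then have "(\<Sum>i\<in>UNIV. \<bar>(mean_opinion p x - mean_opinion p y) $ i\<bar>)
        \<le> (\<Sum>i\<in>(UNIV::'n set). (N * L * \<bar>R\<bar> + 1) * norm (x - y))"
      by (intro sum_mono)
    then show ?thesis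
      using norm_le_l1_cart[of "mean_opinion p x - mean_opinion p y"] by (simp add: N_def algebra_simps)
  qed
  then have "(N * (N * L * \<bar>R\<bar> + 1))-lipschitz_on (opinion_box R) (mean_opinion p)"
    using L by (intro lipschitz_onI) (auto simp: dist_norm N_def)
  then show ?thesis by blast
qed

lemma drift_lipschitz: "\<exists>L. L-lipschitz_on (opinion_box R) (drift p)"
proof -
  obtain L where "L-lipschitz_on (opinion_box R) (mean_opinion p)" using mean_opinion_lipschitz by blast
  then have "(L + 1)-lipschitz_on (opinion_box R) (\<lambda>x. mean_opinion p x - x)"
    by (intro lipschitz_on_diff lipschitz_on_id)
  then show ?thesis using drift_eq by (auto simp: fun_eq_iff)
qed

lemma drift_lipschitz_bounded: assumes "bounded B" shows "\<exists>L. L-lipschitz_on B (drift p)"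
proof -
  obtain R where R: "\<And>x. x \<in> B \<Longrightarrow> norm x \<le> R" using assms unfolding bounded_iff by blast
  have "B \<subseteq> opinion_box R"
    using R component_le_norm_cart by (fastforce simp: mem_opinion_box intro: order_trans)
  then show ?thesis using drift_lipschitz lipschitz_on_subset by blast
qed

text \<open>Composing the mean opinion (but not the damping term \<open>- x\<close>) with the projection onto the
  box makes the vector field globally Lipschitz; its solutions cannot leave the box, since they
  are exponential averages of points of the box, so the projection is invisible along them.\<close>

lemma drift_solution:
  assumes x0: "x0 \<in> opinion_box R" and T: "0 \<le> T"
  shows "\<exists>X. solves_ivp T (drift p) x0 X \<and> (\<forall>t\<in>{0..T}. X t \<in> opinion_box R)"
proof -
  let ?cl = "clamp (vec (- R)) (vec R) :: real^'n \<Rightarrow> real^'n"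
  have R: "0 \<le> R" using x0 by (metis abs_ge_zero mem_opinion_box order_trans)
  have cl: "?cl x \<in> opinion_box R" for x
    using R by (intro clamp_in_interval) (auto simp: Basis_vec_def inner_axis)
  obtain L where L: "L-lipschitz_on (opinion_box R) (mean_opinion p)" using mean_opinion_lipschitz by blast
  have "1-lipschitz_on UNIV ?cl"
    by (intro lipschitz_onI) (auto simp: dist_clamps_le_dist_args)
  then have "(L * 1)-lipschitz_on UNIV (\<lambda>x. mean_opinion p (?cl x))"
    using cl by (intro lipschitz_on_compose2 lipschitz_on_subset[OF L]) auto
  then have "(L * 1 + 1)-lipschitz_on UNIV (\<lambda>x. mean_opinion p (?cl x) - x)"
    by (intro lipschitz_on_diff lipschitz_on_id)
  then obtain X where X: "solves_ivp T (\<lambda>x. mean_opinion p (?cl x) - x) x0 X"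
    using picard_lindelof_lipschitz T by blast
  have "\<bar>X t $ i\<bar> \<le> R" if t: "t \<in> {0..T}" for t i
  proof -
    let ?m = "\<lambda>s. mean_opinion p (?cl (X s))"
    \<comment> \<open>The integrating factor removes the damping term \<open>- X s\<close>, leaving
      a derivative controlled by the box.\<close>
    have D: "((\<lambda>s. exp s *\<^sub>R X s) has_vector_derivative exp s *\<^sub>R ?m s) (at s within {0..T})"
      if "s \<in> {0..T}" for s
    proof -
      have "(X has_vector_derivative ?m s - X s) (at s within {0..T})"
        using X that by (simp add: solves_ivp_def)
      then show ?thesis
        by (auto intro!: derivative_eq_intros simp: has_vector_derivative_def algebra_simps)
    qed
    have Di: "((\<lambda>s. exp s * (X s $ i)) has_vector_derivative exp s * (?m s $ i)) (at s within {0..t})"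
      if "s \<in> {0..t}" for s
    proof -
      have "((\<lambda>s. exp s *\<^sub>R X s) has_vector_derivative exp s *\<^sub>R ?m s) (at s within {0..t})"
        using D[of s] that t by (auto intro: has_vector_derivative_within_subset)
      from bounded_linear.has_vector_derivative[OF bounded_linear_vec_nth this, of i] show ?thesis by simp
    qed
    have "((\<lambda>s. exp s * (?m s $ i)) has_integral exp t * (X t $ i) - exp 0 * (X 0 $ i)) {0..t}"
      using t Di by (intro fundamental_theorem_of_calculus) auto
    moreover have "((\<lambda>s. exp s * R) has_integral exp t * R - exp 0 * R) {0..t}"
      using t by (intro fundamental_theorem_of_calculus)
        (auto intro!: derivative_eq_intros simp: has_real_derivative_iff_has_vector_derivative[symmetric])
    moreover have "\<bar>?m s $ i\<bar> \<le> R" for s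
      using mean_opinion_in[OF cl] by (simp add: mem_opinion_box)
    then have "norm (exp s * (?m s $ i)) \<le> exp s * R" for s
      by (simp add: abs_mult mult_left_mono)
    \<comment> \<open>The increment is at most \<open>(exp t - 1) * R\<close>; adding the initial
      value, at most \<open>R\<close>, gives \<open>exp t * R\<close>, and the exponential
      cancels.\<close>
    ultimately have "norm (exp t * (X t $ i) - exp 0 * (X 0 $ i)) \<le> exp t * R - exp 0 * R"
      by (metis (no_types, lifting) has_integral_iff integral_norm_bound_integral)
    moreover have "\<bar>X 0 $ i\<bar> \<le> R" using X x0 by (simp add: solves_ivp_def mem_opinion_box)
    ultimately have "\<bar>exp t * (X t $ i)\<bar> \<le> exp t * R"
      unfolding real_norm_def exp_zero mult_1 abs_le_iff by linarith
    then show ?thesis by (simp add: abs_mult)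
  qed
  then have box: "X t \<in> opinion_box R" if "t \<in> {0..T}" for t using that by (simp add: mem_opinion_box)
  then have "?cl (X t) = X t" if "t \<in> {0..T}" for t
    using that by (intro clamp_cancel_cbox)
  then have "solves_ivp T (drift p) x0 X"
    using X by (simp add: solves_ivp_def drift_eq)
  with box show ?thesis by blast
qed

section \<open>The interaction kernel as a fluid kernel\<close>

lemma finite_abm_kernel: "finite (set_pmf (abm_kernel p \<mu> y))"
  by (simp add: abm_kernel_def)

lemma abm_kernel_cases:
  assumes "z \<in> set_pmf (abm_kernel p \<mu> y)"
  obtains i j where "z = interact \<mu> i j y"
  using assms by (auto simp: abm_kernel_def)

text \<open>Choosing \<open>i\<close> moves coordinate \<open>i\<close> only, by
  \<open>N * h\<close> times the drift component on average over \<open>j\<close>; the uniform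
  choice of \<open>i\<close> divides by \<open>N\<close>.\<close>

lemma abm_kernel_mean:
  "measure_pmf.expectation (abm_kernel p (real CARD('n) * h) y) (\<lambda>z. z - y) = h *\<^sub>R drift p y"
proof -
  have inner: "measure_pmf.expectation (embed_pmf (select_prob p i y)) (\<lambda>j. axis i (a * (y $ j - y $ i)))
      = axis i (a * drift p y $ i)" for i and a :: real
  proof -
    have "measure_pmf.expectation (embed_pmf (select_prob p i y)) (\<lambda>j. axis i (a * (y $ j - y $ i)))
      = (\<Sum>j\<in>UNIV. select_prob p i y j *\<^sub>R axis i (a * (y $ j - y $ i)))"
      by (subst integral_measure_pmf[of UNIV]) (auto simp: pmf_select)
    also have "\<dots> = axis i (a * drift p y $ i)"
      by (auto simp: vec_eq_iff axis_def drift_def select_prob_def sum_distrib_left divide_inverse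
          intro!: sum.cong)
    finally show ?thesis .
  qed
  have "measure_pmf.expectation (abm_kernel p (real CARD('n) * h) y) (\<lambda>z. z - y)
      = (\<Sum>i\<in>UNIV. axis i (real CARD('n) * h * drift p y $ i) /\<^sub>R real CARD('n))"
    unfolding abm_kernel_def
    by (subst pmf_expectation_bind_pmf_of_set) (auto simp: interact_minus inner)
  also have "\<dots> = h *\<^sub>R drift p y"
    by (auto simp: vec_eq_iff axis_def sum.delta if_distrib cong: if_cong)
  finally show ?thesis .
qed

end

text \<open>The speed is the update distance \<open>N * h\<close> times the largest difference
  \<open>2 * R\<close> of two opinions, per time \<open>h\<close>. The radius \<open>N * R\<close>
  comes from bounding the Euclidean norm by the sum of the coordinates.\<close>

lemma (in interaction_rates) abm_fluid_kernel:
  assumes h: "0 < h" "real CARD('n) * h \<le> 1"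
    and L: "L-lipschitz_on (opinion_box R) (drift p)"
    and T: "0 \<le> T" and X: "solves_ivp T (drift p) x0 X" "\<And>t. t \<in> {0..T} \<Longrightarrow> X t \<in> opinion_box R"
  shows "fluid_kernel (opinion_box R) (drift p) (abm_kernel p (real CARD('n) * h)) h
    (real CARD('n) * (2 * R)) L (real CARD('n) * R) T x0 X"
proof
  fix y z :: "real^'n" assume y: "y \<in> opinion_box R" and "z \<in> set_pmf (abm_kernel p (real CARD('n) * h) y)"
  then obtain i j where z: "z = interact (real CARD('n) * h) i j y" using abm_kernel_cases by blast
  show "z \<in> opinion_box R" unfolding z using y h by (intro interact_in) auto
  show "norm (z - y) \<le> real CARD('n) * (2 * R) * h"
    unfolding z using norm_interact_minus_le[OF y, of "real CARD('n) * h" i j] h by (simp add: mult_ac)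
next
  fix y :: "real^'n" assume y: "y \<in> opinion_box R"
  have "(\<Sum>i\<in>UNIV. \<bar>y $ i\<bar>) \<le> (\<Sum>i\<in>(UNIV :: 'n set). R)"
    by (intro sum_mono) (use y in \<open>simp add: mem_opinion_box\<close>)
  then show "norm y \<le> real CARD('n) * R" using norm_le_l1_cart[of y] by simp
qed (use h L T X in \<open>auto simp: finite_abm_kernel abm_kernel_mean\<close>)

theorem mainTheorem4:
  fixes p :: "'n::finite \<Rightarrow> 'n \<Rightarrow> real^'n \<Rightarrow> real"
    and T :: real and x0 :: "real^'n"
    and M :: "real \<Rightarrow> 'a measure" and x :: "real \<Rightarrow> nat \<Rightarrow> 'a \<Rightarrow> real^'n"
  assumes T: "0 \<le> T"
    and p_range: "\<And>i j y. p i j y \<in> {0..1}"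
    and p_lipschitz: "\<And>i j. \<exists>L. L-lipschitz_on UNIV (p i j)"
    and p_diag: "\<exists>c>0. \<forall>i y. p i i y > c"
    and chain: "\<And>h. h > 0 \<Longrightarrow> markov_chain (M h) (x h) (abm_kernel p (real CARD('n) * h)) x0"
  shows "\<exists>X. solves_ivp T (drift p) x0 X \<and>
           (\<forall>Y. solves_ivp T (drift p) x0 Y \<longrightarrow> (\<forall>t\<in>{0..T}. Y t = X t)) \<and>
           converges_in_distribution (skorokhod_topology T)
             M (\<lambda>h \<omega>. trajectory T h (\<lambda>k. x h k \<omega>))
             (measure_pmf (return_pmf ())) (\<lambda>_. restrict X {0..T})
             (at_right 0)"
proof -
  obtain c where "c > 0" "\<forall>i y. p i i y > c" using p_diag by blast
  then interpret interaction_rates p c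
    using p_range p_lipschitz by unfold_locales auto
  define R where "R = norm x0"
  have "x0 \<in> opinion_box R"
    unfolding R_def mem_opinion_box using component_le_norm_cart by blast
  then obtain X where X: "solves_ivp T (drift p) x0 X" "\<And>t. t \<in> {0..T} \<Longrightarrow> X t \<in> opinion_box R"
    using drift_solution T by blast
  obtain L where L: "L-lipschitz_on (opinion_box R) (drift p)" using drift_lipschitz by blast
  \<comment> \<open>Below this threshold updates are convex combinations and the box is
    invariant.\<close>
  have "\<forall>\<^sub>F h in at_right 0. h < 1 / real CARD('n)"
    by (rule order_tendstoD(2)[OF tendsto_ident_at]) simp
  with eventually_at_right_less[of "0::real"]
  have "\<forall>\<^sub>F h in at_right 0. fluid_kernel (opinion_box R) (drift p) (abm_kernel p (real CARD('n) * h)) h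
      (real CARD('n) * (2 * R)) L (real CARD('n) * R) T x0 X"
    by eventually_elim (intro abm_fluid_kernel L T X, auto simp: field_simps)
  then have "converges_in_distribution (skorokhod_topology T)
      M (\<lambda>h \<omega>. trajectory T h (\<lambda>k. x h k \<omega>))
      (measure_pmf (return_pmf ())) (\<lambda>_. restrict X {0..T}) (at_right 0)"
    using chain by (rule fluid_limit)
  moreover have "Y t = X t" if "solves_ivp T (drift p) x0 Y" "t \<in> {0..T}" for Y t
    using X(1) that drift_lipschitz_bounded by (intro solves_ivp_unique)
  ultimately show ?thesis using X(1) by blast
qed

end
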